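(* Let $(K,\nu)$ be a non-trivial valuation field, let $X$ be a finite-dimensional vector space over $K$, and let $T\in\tau_K(X)$ be a compatible topology on $X$. Then $T$ is a Hausdorff topology if and only if $\hat F(T)\cap I(X)=\{0\}$.
   Context: A topology on a set is a family of subsets satisfying the open set axioms. A valuation on a (commutative) field $K$ is a function $\nu:K\to\mathbb{R}$ with $\nu(\alpha)\ge 0$; $\nu(\alpha)=0\Leftrightarrow\alpha=0$; $\nu(\alpha\beta)=\nu(\alpha)\nu(\beta)$; $\nu(\alpha+\beta)\le\nu(\alpha)+\nu(\beta)$ for all $\alpha,\beta\in K$. The valuation field $(K,\nu)$ carries the topology of the metric $d_\nu(\alpha,\beta)=\nu(\alpha-\beta)$; it is non-trivial if this topology is not discrete. $\hat K$ denotes the metric completion of $(K,d_\nu)$, a valuation field with the extended operations and the extended valuation $\hat\nu$. For a vector space $Z$ over a Hausdorff topological field $k$, a (possibly non-Hausdorff) topology on $Z$ is compatible if addition $Z\times Z\to Z$ and scalar multiplication $k\times Z\to Z$ are continuous (product topologies on the domains). $\tau_k(Z)$ is the set of all compatible topologies on $Z$, and $T_k^{\max}(Z)$ is the largest element of $\tau_k(Z)$ with respect to inclusion (it exists). $\mathrm{cl}_T[A]$ is the closure of $A$ with respect to $T$. Put $\hat X=\hat K\otimes_K X$ and let $I:X\to\hat X$, $I(x)=1\otimes x$ (injective). For $T\in\tau_K(X)$ define $$\hat F(T)=\bigcap_{0\in U\in T}\mathrm{cl}_{T_{\hat K}^{\max}(\hat X)}[I(U)],$$ which is a $\hat K$-subspace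 of $\hat X$. *)

theory Defs
  imports "HOL-Analysis.Analysis" "HOL-Algebra.Module" "HOL-Algebra.QuotRing" "HOL-Algebra.Free_Abelian_Groups"
begin

section \<open>Valuation fields\<close>

locale valuation_field = Ring.field K for K (structure) +
  fixes \<nu> :: "'a \<Rightarrow> real"
  assumes val_nonneg: "\<alpha> \<in> carrier K \<Longrightarrow> 0 \<le> \<nu> \<alpha>"
    and val_eq_0_iff: "\<alpha> \<in> carrier K \<Longrightarrow> \<nu> \<alpha> = 0 \<longleftrightarrow> \<alpha> = \<zero>"
    and val_mult: "\<alpha> \<in> carrier K \<Longrightarrow> \<beta> \<in> carrier K \<Longrightarrow> \<nu> (\<alpha> \<otimes> \<beta>) = \<nu> \<alpha> * \<nu> \<beta>"
    and val_add: "\<alpha> \<in> carrier K \<Longrightarrow> \<beta> \<in> carrier K \<Longrightarrow> \<nu> (\<alpha> \<oplus> \<beta>) \<le> \<nu> \<alpha> + \<nu> \<beta>"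

text \<open>The value outside the carrier is irrelevant; it is set to 0 because the locale
  \<^locale>\<open>Metric_space\<close> asks for nonnegativity and symmetry on the whole type.\<close>

definition val_dist :: "('k, 'm) ring_scheme \<Rightarrow> ('k \<Rightarrow> real) \<Rightarrow> 'k \<Rightarrow> 'k \<Rightarrow> real" where
  "val_dist K \<nu> \<alpha> \<beta> =
     (if \<alpha> \<in> carrier K \<and> \<beta> \<in> carrier K then \<nu> (\<alpha> \<ominus>\<^bsub>K\<^esub> \<beta>) else 0)"

definition val_topology :: "('k, 'm) ring_scheme \<Rightarrow> ('k \<Rightarrow> real) \<Rightarrow> 'k topology" where
  "val_topology K \<nu> = Metric_space.mtopology (carrier K) (val_dist K \<nu>)"

definition nontrivial_valuation :: "('k, 'm) ring_scheme \<Rightarrow> ('k \<Rightarrow> real) \<Rightarrow> bool" where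
  "nontrivial_valuation K \<nu> \<longleftrightarrow> val_topology K \<nu> \<noteq> discrete_topology (carrier K)"

lemma (in valuation_field) val_uminus:
  assumes "\<alpha> \<in> carrier K"
  shows "\<nu> (\<ominus> \<alpha>) = \<nu> \<alpha>"
proof -
  have one: "\<nu> \<one> = 1"
    using val_mult[of \<one> \<one>] val_eq_0_iff[of \<one>] by simp
  have "\<nu> (\<ominus> \<one>) * \<nu> (\<ominus> \<one>) = 1"
    using val_mult[of "\<ominus> \<one>" "\<ominus> \<one>"] one by (simp add: l_minus r_minus)
  then have m1: "\<nu> (\<ominus> \<one>) = 1"
    using val_nonneg[of "\<ominus> \<one>"] by (simp add: square_eq_1_iff)
  have "\<ominus> \<alpha> = \<ominus> \<one> \<otimes> \<alpha>"
    using assms by (simp add: l_minus)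
  then show ?thesis
    using assms m1 val_mult[of "\<ominus> \<one>" \<alpha>] by simp
qed

lemma (in valuation_field) Metric_space_val_dist:
  "Metric_space (carrier K) (val_dist K \<nu>)"
proof
  fix x y z
  show "0 \<le> val_dist K \<nu> x y"
    by (simp add: val_dist_def val_nonneg)
  have "\<nu> (x \<ominus> y) = \<nu> (y \<ominus> x)" if "x \<in> carrier K" "y \<in> carrier K"
  proof -
    have "x \<ominus> y = \<ominus> (y \<ominus> x)"
      using that by (simp add: minus_eq minus_add a_comm)
    then show ?thesis
      using that val_uminus[of "y \<ominus> x"] by simp
  qed
  then show "val_dist K \<nu> x y = val_dist K \<nu> y x"
    by (simp add: val_dist_def)
  show "val_dist K \<nu> x y = 0 \<longleftrightarrow> x = y" if "x \<in> carrier K" "y \<in> carrier K"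
  proof -
    have "x = y" if "x \<ominus> y = \<zero>"
    proof -
      have "x = (x \<ominus> y) \<oplus> y"
        using \<open>x \<in> carrier K\<close> \<open>y \<in> carrier K\<close> by algebra
      then show ?thesis
        using that \<open>y \<in> carrier K\<close> by simp
    qed
    moreover have "x \<ominus> x = \<zero>"
      using that by algebra
    ultimately show ?thesis
      using that by (auto simp: val_dist_def val_eq_0_iff)
  qed
  show "val_dist K \<nu> x z \<le> val_dist K \<nu> x y + val_dist K \<nu> y z"
    if "x \<in> carrier K" "y \<in> carrier K" "z \<in> carrier K"
  proof -
    have "x \<ominus> z = (x \<ominus> y) \<oplus> (y \<ominus> z)"
      using that by algebra
    then show ?thesis
      using that val_add[of "x \<ominus> y" "y \<ominus> z"] by (simp add: val_dist_def)
  qed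
qed


section \<open>Completion of a valuation field\<close>

text \<open>The completion is the ring of Cauchy sequences, with pointwise operations, modulo the
  ideal of null sequences.\<close>

definition cauchy_ring :: "('k, 'm) ring_scheme \<Rightarrow> ('k \<Rightarrow> real) \<Rightarrow> (nat \<Rightarrow> 'k) ring" where
  "cauchy_ring K \<nu> =
    \<lparr>carrier = {s. Metric_space.MCauchy (carrier K) (val_dist K \<nu>) s},
     monoid.mult = (\<lambda>s t n. s n \<otimes>\<^bsub>K\<^esub> t n),
     monoid.one = (\<lambda>n. \<one>\<^bsub>K\<^esub>),
     ring.zero = (\<lambda>n. \<zero>\<^bsub>K\<^esub>),
     ring.add = (\<lambda>s t n. s n \<oplus>\<^bsub>K\<^esub> t n)\<rparr>"

definition null_ideal :: "('k, 'm) ring_scheme \<Rightarrow> ('k \<Rightarrow> real) \<Rightarrow> (nat \<Rightarrow> 'k) set" where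
  "null_ideal K \<nu> =
     {s \<in> carrier (cauchy_ring K \<nu>). limitin (val_topology K \<nu>) s \<zero>\<^bsub>K\<^esub> sequentially}"

definition completion :: "('k, 'm) ring_scheme \<Rightarrow> ('k \<Rightarrow> real) \<Rightarrow> (nat \<Rightarrow> 'k) set ring" where
  "completion K \<nu> = cauchy_ring K \<nu> Quot null_ideal K \<nu>"

definition to_completion :: "('k, 'm) ring_scheme \<Rightarrow> ('k \<Rightarrow> real) \<Rightarrow> 'k \<Rightarrow> (nat \<Rightarrow> 'k) set" where
  "to_completion K \<nu> \<alpha> = null_ideal K \<nu> +>\<^bsub>cauchy_ring K \<nu>\<^esub> (\<lambda>n. \<alpha>)"

text \<open>The limit does not depend on the representative \<open>s\<close> of the class \<open>A\<close>.\<close>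

definition completion_val :: "('k \<Rightarrow> real) \<Rightarrow> (nat \<Rightarrow> 'k) set \<Rightarrow> real" where
  "completion_val \<nu> A = (THE r. \<forall>s\<in>A. (\<lambda>n. \<nu> (s n)) \<longlonglongrightarrow> r)"


section \<open>Finite-dimensional spaces and compatible topologies\<close>

text \<open>Vector spaces are modules over a field.\<close>

definition finite_basis ::
    "('k, 'm) ring_scheme \<Rightarrow> ('k, 'x, 'n) module_scheme \<Rightarrow> 'x set \<Rightarrow> bool" where
  "finite_basis K X B \<longleftrightarrow>
     finite B \<and> B \<subseteq> carrier X \<and>
     (\<forall>x\<in>carrier X. \<exists>a\<in>B \<rightarrow> carrier K. x = finsum X (\<lambda>b. a b \<odot>\<^bsub>X\<^esub> b) B) \<and>
     (\<forall>a\<in>B \<rightarrow> carrier K. finsum X (\<lambda>b. a b \<odot>\<^bsub>X\<^esub> b) B = \<zero>\<^bsub>X\<^esub> \<longrightarrow> (\<forall>b\<in>B. a b = \<zero>\<^bsub>K\<^esub>))"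

definition finite_dimensional ::
    "('k, 'm) ring_scheme \<Rightarrow> ('k, 'x, 'n) module_scheme \<Rightarrow> bool" where
  "finite_dimensional K X \<longleftrightarrow> (\<exists>B. finite_basis K X B)"

text \<open>Here \<open>S\<close> is the topology of the scalar field.\<close>

definition compatible_topologies ::
    "('k, 'm) ring_scheme \<Rightarrow> 'k topology \<Rightarrow> ('k, 'z, 'n) module_scheme \<Rightarrow> 'z topology set" where
  "compatible_topologies K S Z =
     {T. topspace S = carrier K \<and> topspace T = carrier Z \<and>
         continuous_map (prod_topology T T) T (\<lambda>(x, y). x \<oplus>\<^bsub>Z\<^esub> y) \<and>
         continuous_map (prod_topology S T) T (\<lambda>(a, x). a \<odot>\<^bsub>Z\<^esub> x)}"

definition max_topology ::
    "('k, 'm) ring_scheme \<Rightarrow> 'k topology \<Rightarrow> ('k, 'z, 'n) module_scheme \<Rightarrow> 'z topology" where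
  "max_topology K S Z =
     (THE T. T \<in> compatible_topologies K S Z \<and>
        (\<forall>T'\<in>compatible_topologies K S Z. \<forall>U. openin T' U \<longrightarrow> openin T U))"


section \<open>Extension of scalars\<close>

text \<open>For a homomorphism \<open>\<iota>\<close> from \<open>K\<close> to a commutative ring \<open>L\<close>, the tensor product
  \<open>L \<otimes>\<^sub>K X\<close> is the free abelian group on the pairs \<open>(c, x)\<close> modulo the subgroup generated
  by the usual relations. The library's group operation on the free abelian group is called
  multiplication although it is addition of finitely supported functions.\<close>

definition tensor_group ::
    "('l, 'm1) ring_scheme \<Rightarrow> ('k, 'x, 'n) module_scheme \<Rightarrow> ('l \<times> 'x \<Rightarrow>\<^sub>0 int) monoid" where
  "tensor_group L X = free_Abelian_group (carrier L \<times> carrier X)"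

definition tensor_relations ::
    "('k, 'm) ring_scheme \<Rightarrow> ('l, 'm1) ring_scheme \<Rightarrow> ('k \<Rightarrow> 'l) \<Rightarrow> ('k, 'x, 'n) module_scheme
       \<Rightarrow> ('l \<times> 'x \<Rightarrow>\<^sub>0 int) set" where
  "tensor_relations K L \<iota> X =
     {frag_of (c \<oplus>\<^bsub>L\<^esub> d, x) - frag_of (c, x) - frag_of (d, x) | c d x.
        c \<in> carrier L \<and> d \<in> carrier L \<and> x \<in> carrier X} \<union>
     {frag_of (c, x \<oplus>\<^bsub>X\<^esub> y) - frag_of (c, x) - frag_of (c, y) | c x y.
        c \<in> carrier L \<and> x \<in> carrier X \<and> y \<in> carrier X} \<union>
     {frag_of (c \<otimes>\<^bsub>L\<^esub> \<iota> a, x) - frag_of (c, a \<odot>\<^bsub>X\<^esub> x) | c a x.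
        c \<in> carrier L \<and> a \<in> carrier K \<and> x \<in> carrier X}"

definition tensor_null ::
    "('k, 'm) ring_scheme \<Rightarrow> ('l, 'm1) ring_scheme \<Rightarrow> ('k \<Rightarrow> 'l) \<Rightarrow> ('k, 'x, 'n) module_scheme
       \<Rightarrow> ('l \<times> 'x \<Rightarrow>\<^sub>0 int) set" where
  "tensor_null K L \<iota> X = generate (tensor_group L X) (tensor_relations K L \<iota> X)"

definition tensor ::
    "('k, 'm) ring_scheme \<Rightarrow> ('l, 'm1) ring_scheme \<Rightarrow> ('k \<Rightarrow> 'l) \<Rightarrow> ('k, 'x, 'n) module_scheme
       \<Rightarrow> 'l \<Rightarrow> 'x \<Rightarrow> ('l \<times> 'x \<Rightarrow>\<^sub>0 int) set" where
  "tensor K L \<iota> X c x = tensor_null K L \<iota> X #>\<^bsub>tensor_group L X\<^esub> frag_of (c, x)"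

text \<open>The scalar \<open>c\<close> sends the class of \<open>\<Sum>\<^sub>i n\<^sub>i (d\<^sub>i, x\<^sub>i)\<close> to the class of
  \<open>\<Sum>\<^sub>i n\<^sub>i (c d\<^sub>i, x\<^sub>i)\<close>; as this does not depend on the representative, the union below is
  a single class. The ring multiplication and unit that the record type of modules inherits
  play no role.\<close>

definition extend_scalars ::
    "('k, 'm) ring_scheme \<Rightarrow> ('l, 'm1) ring_scheme \<Rightarrow> ('k \<Rightarrow> 'l) \<Rightarrow> ('k, 'x, 'n) module_scheme
       \<Rightarrow> ('l, ('l \<times> 'x \<Rightarrow>\<^sub>0 int) set) module" where
  "extend_scalars K L \<iota> X =
     (let G = tensor_group L X; N = tensor_null K L \<iota> X in
      \<lparr>carrier = carrier (G Mod N),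
       monoid.mult = undefined,
       monoid.one = undefined,
       ring.zero = \<one>\<^bsub>G Mod N\<^esub>,
       ring.add = monoid.mult (G Mod N),
       smult = (\<lambda>c A. \<Union>p\<in>A. N #>\<^bsub>G\<^esub> frag_extend (\<lambda>(d, x). frag_of (c \<otimes>\<^bsub>L\<^esub> d, x)) p)\<rparr>)"


section \<open>The space \<open>X\<close>-hat, the embedding \<open>I\<close> and the subspace \<open>F\<close>-hat\<close>

definition hat_space ::
    "('k, 'm) ring_scheme \<Rightarrow> ('k \<Rightarrow> real) \<Rightarrow> ('k, 'x, 'n) module_scheme
       \<Rightarrow> ((nat \<Rightarrow> 'k) set, ((nat \<Rightarrow> 'k) set \<times> 'x \<Rightarrow>\<^sub>0 int) set) module" where
  "hat_space K \<nu> X = extend_scalars K (completion K \<nu>) (to_completion K \<nu>) X"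

definition hat_embed ::
    "('k, 'm) ring_scheme \<Rightarrow> ('k \<Rightarrow> real) \<Rightarrow> ('k, 'x, 'n) module_scheme
       \<Rightarrow> 'x \<Rightarrow> ((nat \<Rightarrow> 'k) set \<times> 'x \<Rightarrow>\<^sub>0 int) set" where
  "hat_embed K \<nu> X x =
     tensor K (completion K \<nu>) (to_completion K \<nu>) X \<one>\<^bsub>completion K \<nu>\<^esub> x"

definition hat_topology ::
    "('k, 'm) ring_scheme \<Rightarrow> ('k \<Rightarrow> real) \<Rightarrow> ('k, 'x, 'n) module_scheme
       \<Rightarrow> ((nat \<Rightarrow> 'k) set \<times> 'x \<Rightarrow>\<^sub>0 int) set topology" where
  "hat_topology K \<nu> X =
     max_topology (completion K \<nu>) (val_topology (completion K \<nu>) (completion_val \<nu>))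
       (hat_space K \<nu> X)"

definition F_hat ::
    "('k, 'm) ring_scheme \<Rightarrow> ('k \<Rightarrow> real) \<Rightarrow> ('k, 'x, 'n) module_scheme \<Rightarrow> 'x topology
       \<Rightarrow> ((nat \<Rightarrow> 'k) set \<times> 'x \<Rightarrow>\<^sub>0 int) set set" where
  "F_hat K \<nu> X T =
     (\<Inter>U\<in>{U. openin T U \<and> \<zero>\<^bsub>X\<^esub> \<in> U}. hat_topology K \<nu> X closure_of (hat_embed K \<nu> X ` U))"

end

theory Submission
  imports Defs
begin

text \<open>
  For a finite basis \<open>B\<close> of a space over a valuation field, the topology of coordinatewise
  convergence is compatible, and it is the finest compatible topology, because
  \<open>x = \<Sum>\<^sub>b x\<^sub>b b\<close> depends continuously on the coordinates for every compatible topology. Extending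
  the coordinate functionals from \<open>X\<close> to \<open>K\<close>-hat \<open>\<otimes> X\<close> shows that the elements \<open>1 \<otimes> b\<close> form a
  basis, so the topology of \<open>X\<close>-hat is again that of coordinatewise convergence. Since \<open>K\<close> embeds
  isometrically into its completion, every \<open>T\<close>-open \<open>W\<close> around \<open>x\<close> contains the trace on \<open>I(X)\<close>
  of an open set around \<open>I(x)\<close>. If \<open>T\<close> separates \<open>x\<close> from \<open>0\<close> by disjoint open sets \<open>W\<close> and \<open>U\<close>,
  this set misses \<open>I(U)\<close>, and \<open>I(x)\<close> is not in \<open>F\<close>-hat. Conversely, if \<open>T\<close> is not Hausdorff, some
  \<open>x \<noteq> 0\<close> lies in every neighbourhood of \<open>0\<close>, and then \<open>I(x) \<noteq> 0\<close> lies in \<open>F\<close>-hat.\<close>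

section \<open>The completion of a valuation field\<close>

context valuation_field
begin

sublocale val: Metric_space "carrier K" "val_dist K \<nu>"
  by (rule Metric_space_val_dist)

abbreviation (input) "CR \<equiv> cauchy_ring K \<nu>"

section \<open>Elementary estimates for the valuation\<close>

lemma val_zero [simp]: "\<nu> \<zero> = 0"
  by (simp add: val_eq_0_iff)

lemma val_one [simp]: "\<nu> \<one> = 1"
  using val_mult[of \<one> \<one>] val_eq_0_iff[of \<one>] by simp

lemma val_minus_commute:
  "a \<in> carrier K \<Longrightarrow> b \<in> carrier K \<Longrightarrow> \<nu> (a \<ominus> b) = \<nu> (b \<ominus> a)"
  using val.commute[of a b] by (simp add: val_dist_def)

lemma abs_val_diff_le:
  assumes "a \<in> carrier K" "b \<in> carrier K"
  shows "\<bar>\<nu> a - \<nu> b\<bar> \<le> \<nu> (a \<ominus> b)"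
proof -
  have "a = (a \<ominus> b) \<oplus> b" "b = (b \<ominus> a) \<oplus> a"
    using assms by algebra+
  then have "\<nu> a \<le> \<nu> (a \<ominus> b) + \<nu> b" "\<nu> b \<le> \<nu> (b \<ominus> a) + \<nu> a"
    using assms val_add by (metis minus_closed)+
  then show ?thesis
    using val_minus_commute[OF assms] by linarith
qed

lemma val_add_diff_le:
  assumes "a \<in> carrier K" "b \<in> carrier K" "c \<in> carrier K" "d \<in> carrier K"
  shows "\<nu> ((a \<oplus> b) \<ominus> (c \<oplus> d)) \<le> \<nu> (a \<ominus> c) + \<nu> (b \<ominus> d)"
proof -
  have "(a \<oplus> b) \<ominus> (c \<oplus> d) = (a \<ominus> c) \<oplus> (b \<ominus> d)"
    using assms by algebra
  then show ?thesis using assms val_add by simp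
qed

text \<open>The difference of products splits as (a - c) b + c (b - d). Both the closure of Cauchy
  sequences under products and the continuity of multiplication rest on this bound.\<close>

lemma val_mult_diff_le:
  assumes "a \<in> carrier K" "b \<in> carrier K" "c \<in> carrier K" "d \<in> carrier K"
  shows "\<nu> ((a \<otimes> b) \<ominus> (c \<otimes> d)) \<le> \<nu> (a \<ominus> c) * \<nu> b + \<nu> c * \<nu> (b \<ominus> d)"
proof -
  have "(a \<otimes> b) \<ominus> (c \<otimes> d) = (a \<ominus> c) \<otimes> b \<oplus> c \<otimes> (b \<ominus> d)"
    using assms by algebra
  then show ?thesis
    using assms val_add[of "(a \<ominus> c) \<otimes> b" "c \<otimes> (b \<ominus> d)"] by (simp add: val_mult)
qed

section \<open>The ring of Cauchy sequences\<close>

lemma cauchy_ring_iff: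
  "s \<in> carrier CR \<longleftrightarrow>
     (\<forall>n. s n \<in> carrier K) \<and> (\<forall>\<epsilon>>0. \<exists>N. \<forall>m\<ge>N. \<forall>n\<ge>N. \<nu> (s m \<ominus> s n) < \<epsilon>)"
  unfolding cauchy_ring_def val.MCauchy_def by (auto simp: val_dist_def image_subset_iff)

lemma cauchy_ring_closed [simp]: "s \<in> carrier CR \<Longrightarrow> s n \<in> carrier K"
  by (simp add: cauchy_ring_iff)

lemma cauchy_ring_simps [simp]:
  "s \<otimes>\<^bsub>CR\<^esub> t = (\<lambda>n. s n \<otimes> t n)" "s \<oplus>\<^bsub>CR\<^esub> t = (\<lambda>n. s n \<oplus> t n)"
  "\<one>\<^bsub>CR\<^esub> = (\<lambda>n. \<one>)" "\<zero>\<^bsub>CR\<^esub> = (\<lambda>n. \<zero>)"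
  by (simp_all add: cauchy_ring_def)

lemma const_in_cauchy_ring [simp]: "(\<lambda>n. a) \<in> carrier CR \<longleftrightarrow> a \<in> carrier K"
  by (simp add: cauchy_ring_def)

text \<open>By the reverse triangle inequality the values form a Cauchy sequence of reals. Their
  limit becomes the extended valuation, and their boundedness controls products.\<close>

lemma convergent_val:
  assumes "s \<in> carrier CR"
  shows "convergent (\<lambda>n. \<nu> (s n))"
proof -
  have "Cauchy (\<lambda>n. \<nu> (s n))"
  proof (rule metric_CauchyI)
    fix e :: real assume "0 < e"
    then obtain N where N: "\<forall>m\<ge>N. \<forall>n\<ge>N. \<nu> (s m \<ominus> s n) < e"
      using assms by (auto simp: cauchy_ring_iff)
    have "dist (\<nu> (s m)) (\<nu> (s n)) < e" if "m \<ge> N" "n \<ge> N" for m n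
    proof -
      have "dist (\<nu> (s m)) (\<nu> (s n)) \<le> \<nu> (s m \<ominus> s n)"
        using assms abs_val_diff_le by (simp add: dist_real_def)
      also have "\<dots> < e"
        using N that by blast
      finally show ?thesis .
    qed
    then show "\<exists>M. \<forall>m\<ge>M. \<forall>n\<ge>M. dist (\<nu> (s m)) (\<nu> (s n)) < e"
      by blast
  qed
  then show ?thesis by (simp add: Cauchy_convergent)
qed

lemma val_bounded:
  assumes "s \<in> carrier CR"
  obtains B where "B > 0" "\<And>n. \<nu> (s n) \<le> B"
proof -
  have "Bseq (\<lambda>n. \<nu> (s n))"
    using convergent_val[OF assms] by (rule convergent_imp_Bseq)
  then obtain B where "B > 0" "\<forall>n. norm (\<nu> (s n)) \<le> B"
    by (auto elim: BseqE)
  then show thesis using that by (metis abs_le_D1 real_norm_def)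
qed

lemma cauchy_ring_add_closed:
  assumes "s \<in> carrier CR" "t \<in> carrier CR"
  shows "(\<lambda>n. s n \<oplus> t n) \<in> carrier CR"
  unfolding cauchy_ring_iff
proof (intro conjI allI impI)
  fix \<epsilon> :: real assume "\<epsilon> > 0"
  then have "\<epsilon>/2 > 0" by simp
  then obtain M N where M: "\<forall>m\<ge>M. \<forall>n\<ge>M. \<nu> (s m \<ominus> s n) < \<epsilon>/2"
    and N: "\<forall>m\<ge>N. \<forall>n\<ge>N. \<nu> (t m \<ominus> t n) < \<epsilon>/2"
    using assms unfolding cauchy_ring_iff by meson
  have "\<nu> ((s m \<oplus> t m) \<ominus> (s n \<oplus> t n)) < \<epsilon>" if "m \<ge> max M N" "n \<ge> max M N" for m n
  proof -
    have "\<nu> (s m \<ominus> s n) < \<epsilon>/2" "\<nu> (t m \<ominus> t n) < \<epsilon>/2"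
      using M N that by auto
    then show ?thesis
      using val_add_diff_le[of "s m" "t m" "s n" "t n"] assms by simp
  qed
  then show "\<exists>N. \<forall>m\<ge>N. \<forall>n\<ge>N. \<nu> ((s m \<oplus> t m) \<ominus> (s n \<oplus> t n)) < \<epsilon>"
    by blast
qed (use assms in simp)

lemma cauchy_ring_mult_closed:
  assumes "s \<in> carrier CR" "t \<in> carrier CR"
  shows "(\<lambda>n. s n \<otimes> t n) \<in> carrier CR"
  unfolding cauchy_ring_iff
proof (intro conjI allI impI)
  fix \<epsilon> :: real assume "\<epsilon> > 0"
  obtain A where A: "A > 0" "\<And>n. \<nu> (s n) \<le> A" using val_bounded assms(1) by blast
  obtain B where B: "B > 0" "\<And>n. \<nu> (t n) \<le> B" using val_bounded assms(2) by blast
  \<comment> \<open>With these tolerances each of the two terms in \<open>val_mult_diff_le\<close>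
    stays below \<epsilon>/2.\<close>
  have "\<epsilon>/(2*B) > 0" "\<epsilon>/(2*A) > 0"
    using \<open>\<epsilon> > 0\<close> A B by auto
  then obtain M N where M: "\<forall>m\<ge>M. \<forall>n\<ge>M. \<nu> (s m \<ominus> s n) < \<epsilon>/(2*B)"
    and N: "\<forall>m\<ge>N. \<forall>n\<ge>N. \<nu> (t m \<ominus> t n) < \<epsilon>/(2*A)"
    using assms unfolding cauchy_ring_iff by meson
  have "\<nu> ((s m \<otimes> t m) \<ominus> (s n \<otimes> t n)) < \<epsilon>" if "m \<ge> max M N" "n \<ge> max M N" for m n
  proof -
    have "\<nu> (s m \<ominus> s n) < \<epsilon>/(2*B)" "\<nu> (t m \<ominus> t n) < \<epsilon>/(2*A)"
      using M N that by auto
    then have "\<nu> (s m \<ominus> s n) * B < \<epsilon>/2" "A * \<nu> (t m \<ominus> t n) < \<epsilon>/2"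
      using A(1) B(1) by (auto simp: field_simps)
    moreover have "\<nu> (s m \<ominus> s n) * \<nu> (t m) \<le> \<nu> (s m \<ominus> s n) * B"
      "\<nu> (s n) * \<nu> (t m \<ominus> t n) \<le> A * \<nu> (t m \<ominus> t n)"
      using A B assms by (auto intro!: mult_left_mono mult_right_mono val_nonneg)
    ultimately show ?thesis
      using val_mult_diff_le[of "s m" "t m" "s n" "t n"] assms by simp
  qed
  then show "\<exists>N. \<forall>m\<ge>N. \<forall>n\<ge>N. \<nu> ((s m \<otimes> t m) \<ominus> (s n \<otimes> t n)) < \<epsilon>"
    by blast
qed (use assms in simp)

text \<open>Negation is multiplication by the constant sequence -1, so closure under products
  suffices.\<close>

lemma cauchy_ring_uminus_closed:
  assumes "s \<in> carrier CR"
  shows "(\<lambda>n. \<ominus> s n) \<in> carrier CR"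
proof -
  have "(\<lambda>n. (\<ominus> \<one>) \<otimes> s n) \<in> carrier CR"
    by (intro cauchy_ring_mult_closed) (use assms in auto)
  moreover have "(\<ominus> \<one>) \<otimes> s n = \<ominus> s n" for n
    using assms by (simp add: l_minus)
  ultimately show ?thesis by simp
qed

lemma cring_cauchy_ring: "cring CR"
proof (rule cringI)
  show "abelian_group CR"
  proof (rule abelian_groupI)
    show "\<exists>y\<in>carrier CR. y \<oplus>\<^bsub>CR\<^esub> x = \<zero>\<^bsub>CR\<^esub>" if "x \<in> carrier CR" for x
      using that by (intro bexI[of _ "\<lambda>n. \<ominus> x n"]) (auto simp: cauchy_ring_uminus_closed l_neg)
  qed (auto simp: cauchy_ring_add_closed a_ac)
  show "Group.comm_monoid CR"
    by (rule comm_monoidI) (auto simp: cauchy_ring_mult_closed m_ac)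
qed (auto simp: l_distr)

sublocale cauchy: cring CR
  by (rule cring_cauchy_ring)

lemma cauchy_ring_a_inv:
  assumes "s \<in> carrier CR"
  shows "\<ominus>\<^bsub>CR\<^esub> s = (\<lambda>n. \<ominus> s n)"
  using assms by (intro cauchy.minus_equality) (auto simp: cauchy_ring_uminus_closed l_neg)

section \<open>The ideal of null sequences\<close>

lemma null_ideal_iff:
  "s \<in> null_ideal K \<nu> \<longleftrightarrow> s \<in> carrier CR \<and> (\<lambda>n. \<nu> (s n)) \<longlonglongrightarrow> 0"
proof -
  have "limitin (val_topology K \<nu>) s \<zero> sequentially \<longleftrightarrow> (\<lambda>n. \<nu> (s n)) \<longlonglongrightarrow> 0"
    if "s \<in> carrier CR"
    using that unfolding val_topology_def val.limitin_metric_dist_null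
    by (auto simp: val_dist_def minus_eq)
  then show ?thesis by (auto simp: null_ideal_def)
qed

lemma ideal_null_ideal: "ideal (null_ideal K \<nu>) CR"
proof (rule idealI)
  show "ring CR" by unfold_locales
  show "subgroup (null_ideal K \<nu>) (add_monoid CR)"
  proof (rule cauchy.add.subgroupI)
    show "null_ideal K \<nu> \<subseteq> carrier CR" by (auto simp: null_ideal_iff)
    have "(\<lambda>n. \<zero>) \<in> null_ideal K \<nu>" by (simp add: null_ideal_iff)
    then show "null_ideal K \<nu> \<noteq> {}" by blast
  next
    fix s assume s: "s \<in> null_ideal K \<nu>"
    then show "\<ominus>\<^bsub>CR\<^esub> s \<in> null_ideal K \<nu>"
      by (simp add: null_ideal_iff cauchy_ring_a_inv val_uminus cauchy_ring_uminus_closed)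
  next
    fix s t assume s: "s \<in> null_ideal K \<nu>" and t: "t \<in> null_ideal K \<nu>"
    have "(\<lambda>n. \<nu> (s n \<oplus> t n)) \<longlonglongrightarrow> 0"
    proof (rule tendsto_sandwich[where f = "\<lambda>_. 0" and h = "\<lambda>n. \<nu> (s n) + \<nu> (t n)"])
      show "(\<lambda>n. \<nu> (s n) + \<nu> (t n)) \<longlonglongrightarrow> 0"
        using s t by (auto intro: tendsto_add_zero simp: null_ideal_iff)
    qed (use s t in \<open>auto simp: null_ideal_iff val_nonneg val_add\<close>)
    then show "s \<oplus>\<^bsub>CR\<^esub> t \<in> null_ideal K \<nu>"
      using s t by (simp add: null_ideal_iff cauchy_ring_add_closed)
  qed
next
  fix s x assume s: "s \<in> null_ideal K \<nu>" and x: "x \<in> carrier CR"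
  \<comment> \<open>Absorption: the values of the Cauchy sequence \<open>x\<close> converge, so
    their product with values tending to 0 tends to 0.\<close>
  have "(\<lambda>n. \<nu> (x n) * \<nu> (s n)) \<longlonglongrightarrow> lim (\<lambda>n. \<nu> (x n)) * 0"
    using s convergent_val[OF x] by (intro tendsto_mult) (auto simp: null_ideal_iff convergent_LIMSEQ_iff)
  then show "x \<otimes>\<^bsub>CR\<^esub> s \<in> null_ideal K \<nu>"
    using s x by (simp add: null_ideal_iff val_mult cauchy_ring_mult_closed)
  then show "s \<otimes>\<^bsub>CR\<^esub> x \<in> null_ideal K \<nu>"
    using s x by (simp add: null_ideal_iff m_comm)
qed

sublocale null: ideal "null_ideal K \<nu>" CR
  by (rule ideal_null_ideal)

section \<open>The quotient as a valuation field\<close>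

definition cauchy_class :: "(nat \<Rightarrow> 'a) \<Rightarrow> (nat \<Rightarrow> 'a) set" where
  "cauchy_class s = null_ideal K \<nu> +>\<^bsub>CR\<^esub> s"

lemma cring_completion: "cring (completion K \<nu>)"
  unfolding completion_def by (rule null.quotient_is_cring) unfold_locales

lemma cauchy_class_ring_hom: "cauchy_class \<in> ring_hom CR (completion K \<nu>)"
  using null.rcos_ring_hom by (simp add: cauchy_class_def[abs_def] completion_def)

lemma completion_cases:
  assumes "A \<in> carrier (completion K \<nu>)"
  obtains s where "s \<in> carrier CR" "A = cauchy_class s"
  using assms by (auto simp: completion_def FactRing_def A_RCOSETS_def' cauchy_class_def)

lemma cauchy_class_eq_zero_iff:
  assumes "s \<in> carrier CR"
  shows "cauchy_class s = \<zero>\<^bsub>completion K \<nu>\<^esub> \<longleftrightarrow> (\<lambda>n. \<nu> (s n)) \<longlonglongrightarrow> 0"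
proof -
  have "cauchy_class s = null_ideal K \<nu> \<longleftrightarrow> s \<in> null_ideal K \<nu>"
    using assms null.a_rcos_const null.a_rcos_self unfolding cauchy_class_def by blast
  then show ?thesis
    using assms by (simp add: completion_def FactRing_def null_ideal_iff)
qed

lemma cauchy_class_simps:
  assumes "s \<in> carrier CR" "t \<in> carrier CR"
  shows "cauchy_class s \<otimes>\<^bsub>completion K \<nu>\<^esub> cauchy_class t = cauchy_class (\<lambda>n. s n \<otimes> t n)"
    "cauchy_class s \<oplus>\<^bsub>completion K \<nu>\<^esub> cauchy_class t = cauchy_class (\<lambda>n. s n \<oplus> t n)"
  using ring_hom_mult[OF cauchy_class_ring_hom assms] ring_hom_add[OF cauchy_class_ring_hom assms]
  by simp_all

text \<open>Two representatives of a class differ by a null sequence, so by the reverse triangle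
  inequality their values share one limit. This makes the definite description in
  \<open>completion_val\<close> meaningful.\<close>

lemma tendsto_completion_val:
  assumes "s \<in> carrier CR"
  shows "(\<lambda>n. \<nu> (s n)) \<longlonglongrightarrow> completion_val \<nu> (cauchy_class s)"
proof -
  obtain r where r: "(\<lambda>n. \<nu> (s n)) \<longlonglongrightarrow> r"
    using convergent_val[OF assms] by (auto simp: convergent_def)
  have s: "s \<in> cauchy_class s"
    unfolding cauchy_class_def by (rule null.a_rcos_self[OF assms])
  have "(\<lambda>n. \<nu> (t n)) \<longlonglongrightarrow> r" if t: "t \<in> cauchy_class s" for t
  proof -
    obtain h where h: "h \<in> null_ideal K \<nu>" "t = (\<lambda>n. h n \<oplus> s n)"
      using t by (auto simp: cauchy_class_def a_r_coset_def')
    have "(\<lambda>n. \<nu> (t n) - \<nu> (s n)) \<longlonglongrightarrow> 0"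
    proof (rule Lim_null_comparison[where g = "\<lambda>n. \<nu> (h n)"])
      have "t n \<ominus> s n = h n" for n
      proof -
        have "h n \<in> carrier K" "s n \<in> carrier K"
          using h assms by (auto simp: null_ideal_iff)
        then show ?thesis unfolding h(2) by algebra
      qed
      moreover have "t n \<in> carrier K" for n
        using h assms by (auto simp: null_ideal_iff)
      ultimately show "\<forall>\<^sub>F n in sequentially. norm (\<nu> (t n) - \<nu> (s n)) \<le> \<nu> (h n)"
        using abs_val_diff_le assms by (metis (no_types, lifting) cauchy_ring_closed eventuallyI real_norm_def)
    qed (use h in \<open>simp add: null_ideal_iff\<close>)
    from tendsto_add[OF this r] show ?thesis by simp
  qed
  then have "completion_val \<nu> (cauchy_class s) = r"
    unfolding completion_val_def using s r LIMSEQ_unique by (intro the_equality) blast+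
  then show ?thesis using r by simp
qed

lemma completion_val_eqI:
  assumes "s \<in> carrier CR" "(\<lambda>n. \<nu> (s n)) \<longlonglongrightarrow> r"
  shows "completion_val \<nu> (cauchy_class s) = r"
  using LIMSEQ_unique[OF tendsto_completion_val] assms by blast

text \<open>The values of \<open>s\<close> tend to some r > 0, so \<open>s\<close> eventually stays
  away from zero and its termwise inverses are Cauchy. Early terms may vanish, hence the equation
  holds only eventually, which is enough modulo null sequences.\<close>

lemma cauchy_ring_inverse:
  assumes s: "s \<in> carrier CR" and nz: "\<not> (\<lambda>n. \<nu> (s n)) \<longlonglongrightarrow> 0"
  obtains t where "t \<in> carrier CR" "\<forall>\<^sub>F n in sequentially. s n \<otimes> t n = \<one>"
proof -
  obtain r where r: "(\<lambda>n. \<nu> (s n)) \<longlonglongrightarrow> r"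
    using convergent_val[OF s] by (auto simp: convergent_def)
  have "r \<ge> 0"
    using r by (rule LIMSEQ_le_const) (use s val_nonneg in auto)
  with r nz have "r > 0" by (cases "r = 0") auto
  then have "\<forall>\<^sub>F n in sequentially. \<nu> (s n) > r/2"
    using order_tendstoD(1)[OF r, of "r/2"] by simp
  then obtain N where N: "\<And>n. n \<ge> N \<Longrightarrow> \<nu> (s n) > r/2"
    by (auto simp: eventually_sequentially)
  define t where "t n = (if n \<ge> N then inv (s n) else \<zero>)" for n
  have unit: "s n \<in> Units K" if "n \<ge> N" for n
    using N[OF that] \<open>r > 0\<close> s field_Units by (force simp: val_eq_0_iff)
  have tc: "t n \<in> carrier K" for n
    using unit by (simp add: t_def)
  have st: "s n \<otimes> t n = \<one>" if "n \<ge> N" for n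
    using that unit by (simp add: t_def)
  have "t \<in> carrier CR"
    unfolding cauchy_ring_iff
  proof (intro conjI allI impI)
    fix \<epsilon> :: real assume "\<epsilon> > 0"
    \<comment> \<open>Differences of inverses carry the denominator \<open>s m\<close> times
      \<open>s n\<close>, whose value is at least (r/2)(r/2); the tolerance compensates for
      it.\<close>
    then have "\<epsilon> * (r/2 * (r/2)) > 0" using \<open>r > 0\<close> by simp
    then obtain M where M: "\<forall>m\<ge>M. \<forall>n\<ge>M. \<nu> (s m \<ominus> s n) < \<epsilon> * (r/2 * (r/2))"
      using s unfolding cauchy_ring_iff by meson
    have "\<nu> (t m \<ominus> t n) < \<epsilon>" if mn: "m \<ge> max M N" "n \<ge> max M N" for m n
    proof -
      note c = tc[of m] tc[of n] cauchy_ring_closed[OF s, of m] cauchy_ring_closed[OF s, of n]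
      \<comment> \<open>This is 1/s_m - 1/s_n = (s_n - s_m)/(s_m s_n) with denominators cleared; the
        inserted products equal 1.\<close>
      have "s n \<ominus> s m = (s n \<otimes> (s m \<otimes> t m)) \<ominus> (s m \<otimes> (s n \<otimes> t n))"
        using st mn c by simp
      also have "\<dots> = (t m \<ominus> t n) \<otimes> (s m \<otimes> s n)"
        using c by algebra
      finally have eq: "\<nu> (s n \<ominus> s m) = \<nu> (t m \<ominus> t n) * (\<nu> (s m) * \<nu> (s n))"
        using c by (simp add: val_mult)
      have "r/2 * (r/2) \<le> \<nu> (s m) * \<nu> (s n)"
        using N[of m] N[of n] mn \<open>r > 0\<close> by (intro mult_mono) auto
      then have "\<nu> (t m \<ominus> t n) * (r/2 * (r/2)) \<le> \<nu> (s n \<ominus> s m)"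
        unfolding eq using c val_nonneg by (intro mult_left_mono) auto
      also have "\<dots> < \<epsilon> * (r/2 * (r/2))"
        using M mn by simp
      finally show ?thesis using \<open>r > 0\<close> by (simp add: mult_less_cancel_right)
    qed
    then show "\<exists>N. \<forall>m\<ge>N. \<forall>n\<ge>N. \<nu> (t m \<ominus> t n) < \<epsilon>" by blast
  qed (rule tc)
  moreover have "\<forall>\<^sub>F n in sequentially. s n \<otimes> t n = \<one>"
    using st by (auto simp: eventually_sequentially)
  ultimately show thesis by (rule that)
qed

lemma cauchy_class_one [simp]: "cauchy_class (\<lambda>n. \<one>) = \<one>\<^bsub>completion K \<nu>\<^esub>"
  using ring_hom_one[OF cauchy_class_ring_hom] by simp

lemma cauchy_class_zero [simp]: "cauchy_class (\<lambda>n. \<zero>) = \<zero>\<^bsub>completion K \<nu>\<^esub>"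
  by (simp add: cauchy_class_eq_zero_iff)

lemma cauchy_class_closed [simp]:
  "s \<in> carrier CR \<Longrightarrow> cauchy_class s \<in> carrier (completion K \<nu>)"
  using ring_hom_closed[OF cauchy_class_ring_hom] .

text \<open>The difference is eventually zero, hence null: a class forgets any finite number of
  terms. This turns eventual inverses into genuine ones.\<close>

lemma cauchy_class_cong:
  assumes s: "s \<in> carrier CR" and t: "t \<in> carrier CR" and ev: "\<forall>\<^sub>F n in sequentially. s n = t n"
  shows "cauchy_class s = cauchy_class t"
proof -
  interpret L: cring "completion K \<nu>" by (rule cring_completion)
  have m: "(\<lambda>n. \<ominus> t n) \<in> carrier CR"
    using t by (rule cauchy_ring_uminus_closed)
  have "(\<lambda>n. \<nu> (s n \<oplus> \<ominus> t n)) \<longlonglongrightarrow> 0"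
  proof (rule tendsto_eventually)
    show "\<forall>\<^sub>F n in sequentially. \<nu> (s n \<oplus> \<ominus> t n) = 0"
      using ev by eventually_elim (use t in \<open>simp add: r_neg\<close>)
  qed
  then have "cauchy_class (\<lambda>n. s n \<oplus> \<ominus> t n) = \<zero>\<^bsub>completion K \<nu>\<^esub>"
    using cauchy_ring_add_closed[OF s m] by (simp only: cauchy_class_eq_zero_iff)
  then have "cauchy_class s \<oplus>\<^bsub>completion K \<nu>\<^esub> cauchy_class (\<lambda>n. \<ominus> t n) = \<zero>\<^bsub>completion K \<nu>\<^esub>"
    by (simp only: cauchy_class_simps(2)[OF s m])
  \<comment> \<open>Both classes are now additive inverses of the class of -t, so uniqueness of
    inverses identifies them.\<close>
  moreover have "cauchy_class t \<oplus>\<^bsub>completion K \<nu>\<^esub> cauchy_class (\<lambda>n. \<ominus> t n) = \<zero>\<^bsub>completion K \<nu>\<^esub>"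
    unfolding cauchy_class_simps(2)[OF t m] using t by (simp add: r_neg)
  ultimately show ?thesis
    using L.minus_equality[OF _ cauchy_class_closed[OF m] cauchy_class_closed] s t by metis
qed

text \<open>A nonzero class has a representative that is not null, and the class of its eventual
  inverse is an inverse in the quotient.\<close>

lemma field_completion: "Ring.field (completion K \<nu>)"
proof (rule cring.cring_fieldI2[OF cring_completion])
  have "\<one>\<^bsub>completion K \<nu>\<^esub> \<noteq> \<zero>\<^bsub>completion K \<nu>\<^esub>"
    using cauchy_class_eq_zero_iff[of "\<lambda>n. \<one>"] by (simp add: tendsto_const_iff)
  then show "\<zero>\<^bsub>completion K \<nu>\<^esub> \<noteq> \<one>\<^bsub>completion K \<nu>\<^esub>" by simp
next
  fix A assume A: "A \<in> carrier (completion K \<nu>)" "A \<noteq> \<zero>\<^bsub>completion K \<nu>\<^esub>"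
  obtain s where s: "s \<in> carrier CR" "A = cauchy_class s" using A(1) by (rule completion_cases)
  with A have "\<not> (\<lambda>n. \<nu> (s n)) \<longlonglongrightarrow> 0" by (simp add: cauchy_class_eq_zero_iff)
  then obtain t where t: "t \<in> carrier CR" "\<forall>\<^sub>F n in sequentially. s n \<otimes> t n = \<one>"
    using cauchy_ring_inverse[OF s(1)] by blast
  have "A \<otimes>\<^bsub>completion K \<nu>\<^esub> cauchy_class t = cauchy_class (\<lambda>n. \<one>)"
    using s t cauchy_class_cong[of "\<lambda>n. s n \<otimes> t n" "\<lambda>n. \<one>"]
    by (simp only: cauchy_class_simps cauchy_ring_mult_closed) simp
  then show "\<exists>b\<in>carrier (completion K \<nu>). A \<otimes>\<^bsub>completion K \<nu>\<^esub> b = \<one>\<^bsub>completion K \<nu>\<^esub>"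
    using t by auto
qed

text \<open>The axioms pass to limits along representatives, since products and weak inequalities
  survive limits. Definiteness holds because exactly the null sequences represent zero.\<close>

theorem valuation_field_completion: "valuation_field (completion K \<nu>) (completion_val \<nu>)"
proof (intro valuation_field.intro field_completion valuation_field_axioms.intro)
  fix A assume "A \<in> carrier (completion K \<nu>)"
  then obtain s where s: "s \<in> carrier CR" "A = cauchy_class s" by (rule completion_cases)
  note lim = tendsto_completion_val[OF s(1)]
  show "0 \<le> completion_val \<nu> A"
    unfolding s(2) using lim by (rule LIMSEQ_le_const) (use s val_nonneg in auto)
  show "completion_val \<nu> A = 0 \<longleftrightarrow> A = \<zero>\<^bsub>completion K \<nu>\<^esub>"
    unfolding s(2) cauchy_class_eq_zero_iff[OF s(1)]
    using lim completion_val_eqI[OF s(1)] by metis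
next
  fix A B assume A: "A \<in> carrier (completion K \<nu>)" and B: "B \<in> carrier (completion K \<nu>)"
  obtain s where s: "s \<in> carrier CR" "A = cauchy_class s" using A by (rule completion_cases)
  obtain t where t: "t \<in> carrier CR" "B = cauchy_class t" using B by (rule completion_cases)
  note lim = tendsto_completion_val[OF s(1)] tendsto_completion_val[OF t(1)]
  show "completion_val \<nu> (A \<otimes>\<^bsub>completion K \<nu>\<^esub> B) = completion_val \<nu> A * completion_val \<nu> B"
    unfolding s t cauchy_class_simps[OF s(1) t(1)]
    using tendsto_mult[OF lim] cauchy_ring_mult_closed[OF s(1) t(1)] s(1) t(1)
    by (intro completion_val_eqI) (simp_all only: val_mult cauchy_ring_closed)
  have "(\<lambda>n. \<nu> (s n \<oplus> t n)) \<longlonglongrightarrow> completion_val \<nu> (A \<oplus>\<^bsub>completion K \<nu>\<^esub> B)"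
    unfolding s t cauchy_class_simps[OF s(1) t(1)]
    by (intro tendsto_completion_val cauchy_ring_add_closed s t)
  then show "completion_val \<nu> (A \<oplus>\<^bsub>completion K \<nu>\<^esub> B) \<le> completion_val \<nu> A + completion_val \<nu> B"
    using tendsto_add[OF lim] unfolding s(2)[symmetric] t(2)[symmetric]
    by (rule LIMSEQ_le) (use s(1) t(1) in \<open>simp add: val_add\<close>)
qed

section \<open>The isometric embedding into the completion\<close>

lemma to_completion_eq: "to_completion K \<nu> a = cauchy_class (\<lambda>n. a)"
  by (simp add: to_completion_def cauchy_class_def)

lemma to_completion_ring_hom: "to_completion K \<nu> \<in> ring_hom K (completion K \<nu>)"
  by (rule ring_hom_memI) (simp_all add: to_completion_eq cauchy_class_simps)

lemma completion_val_to_completion [simp]: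
  "a \<in> carrier K \<Longrightarrow> completion_val \<nu> (to_completion K \<nu> a) = \<nu> a"
  unfolding to_completion_eq by (rule completion_val_eqI) auto

end

lemma (in valuation_field) to_completion_val_diff:
  assumes "a \<in> carrier K" "b \<in> carrier K"
  shows "completion_val \<nu> (to_completion K \<nu> a \<ominus>\<^bsub>completion K \<nu>\<^esub> to_completion K \<nu> b) = \<nu> (a \<ominus> b)"
proof -
  interpret h: ring_hom_cring K "completion K \<nu>" "to_completion K \<nu>"
    by (intro ring_hom_cring.intro ring_hom_cring_axioms.intro is_cring cring_completion to_completion_ring_hom)
  have "to_completion K \<nu> a \<ominus>\<^bsub>completion K \<nu>\<^esub> to_completion K \<nu> b = to_completion K \<nu> (a \<ominus> b)"
    using assms by (simp add: a_minus_def)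
  then show ?thesis using assms by simp
qed

text \<open>The embedding is isometric, so a ball around \<open>a\<close> inside \<open>V\<close> is
  the trace of the ball of the same radius in the completion. This is the one-dimensional case of
  the lifting used later for neighbourhoods in X.\<close>

lemma (in valuation_field) openin_val_topology_lift:
  assumes V: "openin (val_topology K \<nu>) V" and a: "a \<in> V"
  shows "\<exists>W. openin (val_topology (completion K \<nu>) (completion_val \<nu>)) W \<and>
    to_completion K \<nu> a \<in> W \<and> (\<forall>b\<in>carrier K. to_completion K \<nu> b \<in> W \<longrightarrow> b \<in> V)"
proof -
  interpret M: Metric_space "carrier (completion K \<nu>)" "val_dist (completion K \<nu>) (completion_val \<nu>)"
    by (rule valuation_field.Metric_space_val_dist[OF valuation_field_completion])
  note closed = ring_hom_closed[OF to_completion_ring_hom]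
  obtain r where "r > 0" and r: "val.mball a r \<subseteq> V" and aK: "a \<in> carrier K"
    using V a unfolding val_topology_def val.openin_mtopology by blast
  have "b \<in> V" if "b \<in> carrier K" "to_completion K \<nu> b \<in> M.mball (to_completion K \<nu> a) r" for b
  proof -
    have "b \<in> val.mball a r"
      using that aK by (simp add: val_dist_def closed to_completion_val_diff)
    then show ?thesis using r by blast
  qed
  then show ?thesis
    unfolding val_topology_def
    using \<open>r > 0\<close> closed[OF aK] by (intro exI[of _ "M.mball (to_completion K \<nu> a) r"]) simp
qed

section \<open>Continuity of the field operations\<close>

lemma (in valuation_field) topspace_val_topology [simp]:
  "topspace (val_topology K \<nu>) = carrier K"
  by (simp add: val_topology_def)

text \<open>Reduces joint continuity to an epsilon-delta estimate, with a product of two balls of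
  radius \<delta> as the neighbourhood in the product topology.\<close>

lemma (in valuation_field) continuous_map_val_topology_binop:
  assumes closed: "\<And>a b. a \<in> carrier K \<Longrightarrow> b \<in> carrier K \<Longrightarrow> f a b \<in> carrier K"
    and est: "\<And>a b \<epsilon>. \<lbrakk>a \<in> carrier K; b \<in> carrier K; 0 < \<epsilon>\<rbrakk> \<Longrightarrow>
      \<exists>\<delta>>0. \<forall>c\<in>carrier K. \<forall>d\<in>carrier K. \<nu> (a \<ominus> c) < \<delta> \<longrightarrow> \<nu> (b \<ominus> d) < \<delta> \<longrightarrow> \<nu> (f a b \<ominus> f c d) < \<epsilon>"
  shows "continuous_map (prod_topology (val_topology K \<nu>) (val_topology K \<nu>))
    (val_topology K \<nu>) (\<lambda>(a, b). f a b)"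
  unfolding val_topology_def val.continuous_map_to_metric
proof (intro ballI allI impI)
  fix p and \<epsilon> :: real
  assume p: "p \<in> topspace (prod_topology val.mtopology val.mtopology)" and "0 < \<epsilon>"
  then obtain a b where ab: "p = (a, b)" "a \<in> carrier K" "b \<in> carrier K"
    by auto
  obtain \<delta> where "\<delta> > 0" and \<delta>: "\<forall>c\<in>carrier K. \<forall>d\<in>carrier K.
      \<nu> (a \<ominus> c) < \<delta> \<longrightarrow> \<nu> (b \<ominus> d) < \<delta> \<longrightarrow> \<nu> (f a b \<ominus> f c d) < \<epsilon>"
    using est[OF ab(2,3) \<open>0 < \<epsilon>\<close>] by blast
  show "\<exists>U. openin (prod_topology val.mtopology val.mtopology) U \<and> p \<in> U \<and>
      (\<forall>q\<in>U. (case q of (c, d) \<Rightarrow> f c d) \<in> val.mball (case p of (c, d) \<Rightarrow> f c d) \<epsilon>)"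
  proof (intro exI conjI)
    show "openin (prod_topology val.mtopology val.mtopology) (val.mball a \<delta> \<times> val.mball b \<delta>)"
      by (simp add: openin_prod_Times_iff)
    show "p \<in> val.mball a \<delta> \<times> val.mball b \<delta>"
      using ab \<open>\<delta> > 0\<close> by simp
    show "\<forall>q\<in>val.mball a \<delta> \<times> val.mball b \<delta>.
        (case q of (c, d) \<Rightarrow> f c d) \<in> val.mball (case p of (c, d) \<Rightarrow> f c d) \<epsilon>"
      using ab \<delta> by (auto simp: val_dist_def closed)
  qed
qed

lemma (in valuation_field) continuous_map_val_add:
  "continuous_map (prod_topology (val_topology K \<nu>) (val_topology K \<nu>))
    (val_topology K \<nu>) (\<lambda>(a, b). a \<oplus> b)"
proof (rule continuous_map_val_topology_binop)
  fix a b and \<epsilon> :: real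
  assume ab: "a \<in> carrier K" "b \<in> carrier K" and "0 < \<epsilon>"
  have "\<nu> ((a \<oplus> b) \<ominus> (c \<oplus> d)) < \<epsilon>"
    if "c \<in> carrier K" "d \<in> carrier K" "\<nu> (a \<ominus> c) < \<epsilon>/2" "\<nu> (b \<ominus> d) < \<epsilon>/2" for c d
    using val_add_diff_le[OF ab that(1,2)] that by linarith
  then show "\<exists>\<delta>>0. \<forall>c\<in>carrier K. \<forall>d\<in>carrier K.
      \<nu> (a \<ominus> c) < \<delta> \<longrightarrow> \<nu> (b \<ominus> d) < \<delta> \<longrightarrow> \<nu> ((a \<oplus> b) \<ominus> (c \<oplus> d)) < \<epsilon>"
    using \<open>0 < \<epsilon>\<close> half_gt_zero by blast
qed simp

lemma (in valuation_field) continuous_map_val_mult: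
  "continuous_map (prod_topology (val_topology K \<nu>) (val_topology K \<nu>))
    (val_topology K \<nu>) (\<lambda>(a, b). a \<otimes> b)"
proof (rule continuous_map_val_topology_binop)
  fix a b and \<epsilon> :: real
  assume ab: "a \<in> carrier K" "b \<in> carrier K" and "0 < \<epsilon>"
  \<comment> \<open>\<open>M\<close> bounds \<nu> b, and also \<nu> c once c is within distance 1 of
    a; the summand 1 serves the latter and keeps \<open>M\<close> positive.\<close>
  define M where "M = 1 + \<nu> a + \<nu> b"
  have nn: "\<nu> a \<ge> 0" "\<nu> b \<ge> 0" using ab val_nonneg by auto
  then have "M \<ge> 1" by (simp add: M_def)
  \<comment> \<open>The cap 1 ensures the bound on \<nu> c; the other term makes 2 M \<delta> at
    most \<epsilon>.\<close>
  define \<delta> where "\<delta> = min 1 (\<epsilon> / (2 * M))"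
  have "\<delta> > 0" using \<open>M \<ge> 1\<close> \<open>0 < \<epsilon>\<close> by (simp add: \<delta>_def)
  have "\<nu> ((a \<otimes> b) \<ominus> (c \<otimes> d)) < \<epsilon>"
    if cd: "c \<in> carrier K" "d \<in> carrier K" and lt: "\<nu> (a \<ominus> c) < \<delta>" "\<nu> (b \<ominus> d) < \<delta>" for c d
  proof -
    have "\<nu> c \<le> \<nu> a + 1"
      using abs_val_diff_le[OF ab(1) cd(1)] lt(1) unfolding \<delta>_def by linarith
    then have c: "\<nu> c \<le> M" and b: "\<nu> b \<le> M" using nn by (auto simp: M_def)
    have "\<nu> (a \<ominus> c) * \<nu> b + \<nu> c * \<nu> (b \<ominus> d) \<le> \<nu> (a \<ominus> c) * M + M * \<nu> (b \<ominus> d)"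
      using b c ab cd val_nonneg by (intro add_mono mult_left_mono mult_right_mono) auto
    also have "\<dots> < \<delta> * M + M * \<delta>"
      using lt \<open>M \<ge> 1\<close> by (intro add_strict_mono mult_strict_left_mono mult_strict_right_mono) auto
    also have "\<dots> \<le> \<epsilon>"
    proof -
      have "\<delta> \<le> \<epsilon> / (2 * M)" by (simp add: \<delta>_def)
      then show ?thesis using \<open>M \<ge> 1\<close> by (simp add: field_simps)
    qed
    finally show ?thesis
      using val_mult_diff_le[OF ab cd] by linarith
  qed
  with \<open>\<delta> > 0\<close> show "\<exists>\<delta>>0. \<forall>c\<in>carrier K. \<forall>d\<in>carrier K.
      \<nu> (a \<ominus> c) < \<delta> \<longrightarrow> \<nu> (b \<ominus> d) < \<delta> \<longrightarrow> \<nu> ((a \<otimes> b) \<ominus> (c \<otimes> d)) < \<epsilon>"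
    by blast
qed simp

section \<open>The topology of coordinatewise convergence\<close>

text \<open>Fixing a basis in a general setting lets the same results serve \<open>X\<close> over
  \<open>K\<close> and the extended space over the completion.\<close>

locale based_module = Module.module K Z for K (structure) and Z (structure) +
  fixes B
  assumes basis: "finite_basis K Z B"
begin

lemma finite_B: "finite B" and B_subset: "B \<subseteq> carrier Z"
  using basis by (auto simp: finite_basis_def)

lemma B_closed [simp]: "b \<in> B \<Longrightarrow> b \<in> carrier Z"
  using B_subset by blast

section \<open>Linear combinations and coordinates\<close>

definition lincomb where "lincomb a = (\<Oplus>\<^bsub>Z\<^esub>b\<in>B. a b \<odot>\<^bsub>Z\<^esub> b)"

lemma lincomb_closed: "a \<in> B \<rightarrow> carrier K \<Longrightarrow> lincomb a \<in> carrier Z"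
  unfolding lincomb_def by (intro M.finsum_closed) auto

lemma lincomb_cong: "(\<And>b. b \<in> B \<Longrightarrow> a b = a' b) \<Longrightarrow> a' \<in> B \<rightarrow> carrier K \<Longrightarrow> lincomb a = lincomb a'"
  unfolding lincomb_def by (intro M.finsum_cong') auto

lemma lincomb_add:
  assumes "a \<in> B \<rightarrow> carrier K" "a' \<in> B \<rightarrow> carrier K"
  shows "lincomb (\<lambda>b. a b \<oplus> a' b) = lincomb a \<oplus>\<^bsub>Z\<^esub> lincomb a'"
proof -
  have "lincomb (\<lambda>b. a b \<oplus> a' b) = (\<Oplus>\<^bsub>Z\<^esub>b\<in>B. a b \<odot>\<^bsub>Z\<^esub> b \<oplus>\<^bsub>Z\<^esub> a' b \<odot>\<^bsub>Z\<^esub> b)"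
    unfolding lincomb_def using assms by (intro M.finsum_cong') (auto simp: smult_l_distr Pi_iff)
  also have "\<dots> = lincomb a \<oplus>\<^bsub>Z\<^esub> lincomb a'"
    unfolding lincomb_def using assms by (intro M.finsum_addf) auto
  finally show ?thesis .
qed

lemma lincomb_smult:
  assumes "a \<in> B \<rightarrow> carrier K" "c \<in> carrier K"
  shows "lincomb (\<lambda>b. c \<otimes> a b) = c \<odot>\<^bsub>Z\<^esub> lincomb a"
proof -
  have "lincomb (\<lambda>b. c \<otimes> a b) = (\<Oplus>\<^bsub>Z\<^esub>b\<in>B. c \<odot>\<^bsub>Z\<^esub> (a b \<odot>\<^bsub>Z\<^esub> b))"
    unfolding lincomb_def using assms by (intro M.finsum_cong') (auto simp: smult_assoc1 Pi_iff)
  also have "\<dots> = c \<odot>\<^bsub>Z\<^esub> lincomb a"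
    unfolding lincomb_def using assms finite_B by (intro finsum_smult_ldistr[symmetric]) auto
  finally show ?thesis .
qed

text \<open>Independence in \<open>finite_basis\<close> concerns combinations equal to zero, so it
  is applied to the coefficientwise difference.\<close>

lemma lincomb_inj:
  assumes a: "a \<in> B \<rightarrow> carrier K" "a' \<in> B \<rightarrow> carrier K" and eq: "lincomb a = lincomb a'" and b: "b \<in> B"
  shows "a b = a' b"
proof -
  define d where "d b = a b \<ominus> a' b" for b
  have d: "d \<in> B \<rightarrow> carrier K" using a by (auto simp: d_def Pi_iff)
  have da: "d b \<oplus> a' b = a b" if "b \<in> B" for b
  proof -
    have "a b \<in> carrier K" "a' b \<in> carrier K" using a that by auto
    then show ?thesis unfolding d_def by algebra
  qed
  have "lincomb d \<oplus>\<^bsub>Z\<^esub> lincomb a' = lincomb a"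
    unfolding lincomb_add[OF d a(2), symmetric] using a da by (intro lincomb_cong) auto
  then have "lincomb d = \<zero>\<^bsub>Z\<^esub>"
    using eq lincomb_closed a d by (metis M.add.r_cancel_one)
  then have "d b = \<zero>"
    using basis d b unfolding finite_basis_def lincomb_def by blast
  then show ?thesis
    using da[OF b] a b by (metis PiE R.l_zero)
qed

text \<open>The family is taken extensional so that it is a point of the product space over
  \<open>B\<close>; its values on \<open>B\<close> are unique by \<open>lincomb_inj\<close>.\<close>

definition coord where
  "coord x = (SOME a. a \<in> B \<rightarrow>\<^sub>E carrier K \<and> lincomb a = x)"

lemma
  assumes "x \<in> carrier Z"
  shows coord_PiE: "coord x \<in> B \<rightarrow>\<^sub>E carrier K" and lincomb_coord: "lincomb (coord x) = x"
proof -
  obtain a where a: "a \<in> B \<rightarrow> carrier K" "x = lincomb a"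
    using basis assms unfolding finite_basis_def lincomb_def by blast
  have "lincomb (restrict a B) = x"
    unfolding a(2) using a(1) by (intro lincomb_cong) auto
  moreover have "restrict a B \<in> B \<rightarrow>\<^sub>E carrier K" using a(1) by auto
  ultimately have "\<exists>a. a \<in> B \<rightarrow>\<^sub>E carrier K \<and> lincomb a = x" by blast
  from someI_ex[OF this] show "coord x \<in> B \<rightarrow>\<^sub>E carrier K" "lincomb (coord x) = x"
    unfolding coord_def by auto
qed

lemma coord_Pi: "x \<in> carrier Z \<Longrightarrow> coord x \<in> B \<rightarrow> carrier K"
  using coord_PiE by blast

lemma coord_closed [simp]: "x \<in> carrier Z \<Longrightarrow> b \<in> B \<Longrightarrow> coord x b \<in> carrier K"
  using coord_PiE by blast

lemma coord_lincomb:
  assumes "a \<in> B \<rightarrow> carrier K" "b \<in> B"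
  shows "coord (lincomb a) b = a b"
proof -
  note x = lincomb_closed[OF assms(1)]
  show ?thesis
    using coord_Pi[OF x] assms(1) lincomb_coord[OF x] assms(2) by (rule lincomb_inj)
qed

lemma coord_eqI:
  assumes "a \<in> B \<rightarrow> carrier K" "lincomb a = x" "b \<in> B"
  shows "coord x b = a b"
  using coord_lincomb assms by blast

lemma coord_add:
  assumes "x \<in> carrier Z" "y \<in> carrier Z" "b \<in> B"
  shows "coord (x \<oplus>\<^bsub>Z\<^esub> y) b = coord x b \<oplus> coord y b"
  by (rule coord_eqI) (use assms coord_Pi in \<open>auto simp: lincomb_add lincomb_coord\<close>)

lemma coord_smult:
  assumes "x \<in> carrier Z" "c \<in> carrier K" "b \<in> B"
  shows "coord (c \<odot>\<^bsub>Z\<^esub> x) b = c \<otimes> coord x b"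
  by (rule coord_eqI) (use assms coord_Pi in \<open>auto simp: lincomb_smult lincomb_coord\<close>)

lemma coord_inj:
  assumes "x \<in> carrier Z" "y \<in> carrier Z" "\<And>b. b \<in> B \<Longrightarrow> coord x b = coord y b"
  shows "x = y"
  using lincomb_cong[OF assms(3) coord_Pi[OF assms(2)]] assms(1,2) by (simp add: lincomb_coord)

section \<open>The initial topology of the coordinate functionals\<close>

definition coordinate_topology where
  "coordinate_topology S = pullback_topology (carrier Z) coord (product_topology (\<lambda>_. S) B)"

lemma topspace_coordinate_topology [simp]:
  assumes "topspace S = carrier K"
  shows "topspace (coordinate_topology S) = carrier Z"
  using coord_PiE assms by (auto simp: coordinate_topology_def topspace_pullback_topology)

lemma continuous_map_coord:
  assumes "b \<in> B"
  shows "continuous_map (coordinate_topology S) S (\<lambda>x. coord x b)"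
proof -
  have "continuous_map (product_topology (\<lambda>_. S) B) S (\<lambda>a. a b)"
    using continuous_map_product_projection[OF assms, of "\<lambda>_. S"] by simp
  from continuous_map_pullback[OF this] show ?thesis
    by (simp add: coordinate_topology_def comp_def)
qed

text \<open>Universal property of the initial topology. The componentwise criterion for products
  also demands extensional values, which \<open>coord\<close> provides.\<close>

lemma continuous_map_into_coordinate_topology:
  assumes "f \<in> topspace X \<rightarrow> carrier Z" "\<And>b. b \<in> B \<Longrightarrow> continuous_map X S (\<lambda>x. coord (f x) b)"
  shows "continuous_map X (coordinate_topology S) f"
  unfolding coordinate_topology_def
proof (rule continuous_map_pullback')
  have "coord (f x) \<in> extensional B" if "x \<in> topspace X" for x
    using assms(1) coord_PiE that by (auto simp: PiE_def Pi_iff)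
  then show "continuous_map X (product_topology (\<lambda>_. S) B) (coord \<circ> f)"
    using assms(2) by (auto simp: continuous_map_componentwise)
qed (use assms(1) in auto)

text \<open>Coordinates of sums and scalar multiples are sums and products of coordinates, so
  continuity reduces to that of the two scalar operations.\<close>

lemma coordinate_topology_compatible:
  assumes S: "topspace S = carrier K"
    and add: "continuous_map (prod_topology S S) S (\<lambda>(a, b). a \<oplus> b)"
    and mult: "continuous_map (prod_topology S S) S (\<lambda>(a, b). a \<otimes> b)"
  shows "coordinate_topology S \<in> compatible_topologies K S Z"
proof -
  let ?T = "coordinate_topology S"
  have 1: "continuous_map (prod_topology ?T ?T) ?T (\<lambda>(x, y). x \<oplus>\<^bsub>Z\<^esub> y)"
  proof (rule continuous_map_into_coordinate_topology)
    fix b assume b: "b \<in> B"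
    have "continuous_map (prod_topology ?T ?T) (prod_topology S S) (\<lambda>p. (coord (fst p) b, coord (snd p) b))"
      by (intro continuous_map_pairedI continuous_map_compose[OF continuous_map_fst, unfolded comp_def]
          continuous_map_compose[OF continuous_map_snd, unfolded comp_def] continuous_map_coord b)
    from continuous_map_compose[OF this add]
    show "continuous_map (prod_topology ?T ?T) S (\<lambda>p. coord (case p of (x, y) \<Rightarrow> x \<oplus>\<^bsub>Z\<^esub> y) b)"
      by (rule continuous_map_eq) (use S b in \<open>auto simp: coord_add\<close>)
  qed (use S in auto)
  have 2: "continuous_map (prod_topology S ?T) ?T (\<lambda>(c, x). c \<odot>\<^bsub>Z\<^esub> x)"
  proof (rule continuous_map_into_coordinate_topology)
    fix b assume b: "b \<in> B"
    have "continuous_map (prod_topology S ?T) (prod_topology S S) (\<lambda>p. (fst p, coord (snd p) b))"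
      by (intro continuous_map_pairedI continuous_map_fst
          continuous_map_compose[OF continuous_map_snd, unfolded comp_def] continuous_map_coord b)
    from continuous_map_compose[OF this mult]
    show "continuous_map (prod_topology S ?T) S (\<lambda>p. coord (case p of (c, x) \<Rightarrow> c \<odot>\<^bsub>Z\<^esub> x) b)"
      by (rule continuous_map_eq) (use S b in \<open>auto simp: coord_smult\<close>)
  qed (use S in auto)
  show ?thesis
    using 1 2 S by (simp add: compatible_topologies_def)
qed

text \<open>The identity from the coordinate topology to \<open>T\<close> is continuous: the basis
  expansion builds it from continuous coordinates by finitely many operations continuous for
  \<open>T\<close>.\<close>

lemma coordinate_topology_finest:
  assumes T: "T \<in> compatible_topologies K S Z" and U: "openin T U"
  shows "openin (coordinate_topology S) U"
proof -
  let ?C = "coordinate_topology S"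
  have tS: "topspace S = carrier K" and tT: "topspace T = carrier Z"
    and add: "continuous_map (prod_topology T T) T (\<lambda>(x, y). x \<oplus>\<^bsub>Z\<^esub> y)"
    and smult: "continuous_map (prod_topology S T) T (\<lambda>(a, x). a \<odot>\<^bsub>Z\<^esub> x)"
    using T by (auto simp: compatible_topologies_def)
  have sm: "continuous_map ?C T (\<lambda>x. coord x b \<odot>\<^bsub>Z\<^esub> b)" if b: "b \<in> B" for b
  proof -
    have "continuous_map ?C (prod_topology S T) (\<lambda>x. (coord x b, b))"
      using b tT by (intro continuous_map_pairedI continuous_map_coord) auto
    from continuous_map_compose[OF this smult] show ?thesis by (simp add: comp_def)
  qed
  \<comment> \<open>Partial sums over subsets \<open>F\<close> of \<open>B\<close> allow an
    induction while the coordinates still refer to the whole basis.\<close>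
  have "continuous_map ?C T (\<lambda>x. \<Oplus>\<^bsub>Z\<^esub>b\<in>F. coord x b \<odot>\<^bsub>Z\<^esub> b)" if "F \<subseteq> B" for F
    using finite_subset[OF that finite_B] that
  proof (induction F rule: finite_induct)
    case empty
    then show ?case using tT by simp
  next
    case (insert b F)
    then have F: "continuous_map ?C T (\<lambda>x. \<Oplus>\<^bsub>Z\<^esub>b\<in>F. coord x b \<odot>\<^bsub>Z\<^esub> b)" and b: "b \<in> B" by auto
    have "continuous_map ?C (prod_topology T T)
        (\<lambda>x. (coord x b \<odot>\<^bsub>Z\<^esub> b, \<Oplus>\<^bsub>Z\<^esub>b\<in>F. coord x b \<odot>\<^bsub>Z\<^esub> b))"
      by (intro continuous_map_pairedI sm b F)
    from continuous_map_compose[OF this add] show ?case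
    proof (rule continuous_map_eq)
      fix x assume "x \<in> topspace ?C"
      then have x: "x \<in> carrier Z" using tS by simp
      have "(\<lambda>b. coord x b \<odot>\<^bsub>Z\<^esub> b) \<in> F \<rightarrow> carrier Z" "coord x b \<odot>\<^bsub>Z\<^esub> b \<in> carrier Z"
        using x insert.prems by (auto intro!: smult_closed)
      then show "((\<lambda>(x, y). x \<oplus>\<^bsub>Z\<^esub> y) \<circ> (\<lambda>x. (coord x b \<odot>\<^bsub>Z\<^esub> b, \<Oplus>\<^bsub>Z\<^esub>b\<in>F. coord x b \<odot>\<^bsub>Z\<^esub> b))) x
          = (\<Oplus>\<^bsub>Z\<^esub>b\<in>insert b F. coord x b \<odot>\<^bsub>Z\<^esub> b)"
        using insert.hyps by simp
    qed
  qed
  from this[of B] have "continuous_map ?C T (\<lambda>x. lincomb (coord x))"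
    by (simp add: lincomb_def)
  \<comment> \<open>Over all of \<open>B\<close> the sum is x itself, so an open set of
    \<open>T\<close> is its own preimage under a continuous map.\<close>
  then have "continuous_map ?C T (\<lambda>x. x)"
    by (rule continuous_map_eq) (use tS in \<open>simp add: lincomb_coord\<close>)
  then have "openin ?C {x \<in> topspace ?C. x \<in> U}"
    using U by (rule openin_continuous_map_preimage)
  moreover have "{x \<in> topspace ?C. x \<in> U} = U"
    using openin_subset[OF U] tS tT by auto
  ultimately show ?thesis by simp
qed

text \<open>Two largest compatible topologies refine each other and hence coincide, so the definite
  description selects the coordinate topology.\<close>

lemma max_topology_eq_coordinate_topology:
  assumes "topspace S = carrier K"
    and "continuous_map (prod_topology S S) S (\<lambda>(a, b). a \<oplus> b)"
    and "continuous_map (prod_topology S S) S (\<lambda>(a, b). a \<otimes> b)"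
  shows "max_topology K S Z = coordinate_topology S"
  unfolding max_topology_def
proof (rule the_equality)
  show "coordinate_topology S \<in> compatible_topologies K S Z \<and>
      (\<forall>T'\<in>compatible_topologies K S Z. \<forall>U. openin T' U \<longrightarrow> openin (coordinate_topology S) U)"
    using coordinate_topology_compatible[OF assms] coordinate_topology_finest by blast
  then show "T = coordinate_topology S"
    if "T \<in> compatible_topologies K S Z \<and>
      (\<forall>T'\<in>compatible_topologies K S Z. \<forall>U. openin T' U \<longrightarrow> openin T U)" for T
    using that by (auto simp: topology_eq)
qed

end

text \<open>Distinct x and y are separated by translating to the origin: a neighbourhood of 0 that
  misses x - y contains a difference set V - V' of neighbourhoods of 0, and then x + V' and y + V
  are disjoint.\<close>

lemma (in Module.module) Hausdorff_space_compatibleI: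
  assumes T: "T \<in> compatible_topologies R S M"
    and sep: "\<And>x. x \<in> carrier M \<Longrightarrow> x \<noteq> \<zero>\<^bsub>M\<^esub> \<Longrightarrow> \<exists>U. openin T U \<and> \<zero>\<^bsub>M\<^esub> \<in> U \<and> x \<notin> U"
  shows "Hausdorff_space T"
  unfolding Hausdorff_space_def
proof (intro allI impI)
  have tS: "topspace S = carrier R" and tT: "topspace T = carrier M"
    and add: "continuous_map (prod_topology T T) T (\<lambda>(x, y). x \<oplus>\<^bsub>M\<^esub> y)"
    and smult: "continuous_map (prod_topology S T) T (\<lambda>(a, x). a \<odot>\<^bsub>M\<^esub> x)"
    using T by (auto simp: compatible_topologies_def)
  \<comment> \<open>Negation is scalar multiplication by -1, hence continuous; so is
    subtraction.\<close>
  have "continuous_map T (prod_topology S T) (\<lambda>x. (\<ominus> \<one>, x))"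
    using tS by (intro continuous_map_pairedI) auto
  from continuous_map_compose[OF this smult]
  have uminus: "continuous_map T T (\<lambda>x. \<ominus>\<^bsub>M\<^esub> x)"
    by (rule continuous_map_eq) (use tT in \<open>simp add: smult_l_minus\<close>)
  have "continuous_map (prod_topology T T) (prod_topology T T) (\<lambda>p. (fst p, \<ominus>\<^bsub>M\<^esub> snd p))"
    by (intro continuous_map_pairedI continuous_map_fst
        continuous_map_compose[OF continuous_map_snd uminus, unfolded comp_def])
  from continuous_map_compose[OF this add]
  have minus: "continuous_map (prod_topology T T) T (\<lambda>p. fst p \<ominus>\<^bsub>M\<^esub> snd p)"
    by (simp add: comp_def minus_eq)
  fix x y assume xy: "x \<in> topspace T \<and> y \<in> topspace T \<and> x \<noteq> y"
  then have "x = (x \<ominus>\<^bsub>M\<^esub> y) \<oplus>\<^bsub>M\<^esub> y"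
    using tT by (simp add: minus_eq M.a_assoc M.l_neg)
  then have "x \<ominus>\<^bsub>M\<^esub> y \<noteq> \<zero>\<^bsub>M\<^esub>" "x \<ominus>\<^bsub>M\<^esub> y \<in> carrier M" using xy tT by auto
  then obtain U where U: "openin T U" "\<zero>\<^bsub>M\<^esub> \<in> U" "x \<ominus>\<^bsub>M\<^esub> y \<notin> U"
    using sep by blast
  have "openin (prod_topology T T) {p \<in> topspace (prod_topology T T). fst p \<ominus>\<^bsub>M\<^esub> snd p \<in> U}" (is "openin _ ?W")
    using minus U(1) by (rule openin_continuous_map_preimage)
  note W = this[unfolded openin_prod_topology_alt, rule_format]
  \<comment> \<open>Continuity of subtraction at the pair (0, 0) produces the two neighbourhoods V
    and V'.\<close>
  have "(\<zero>\<^bsub>M\<^esub>, \<zero>\<^bsub>M\<^esub>) \<in> ?W"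
    using U(2) tT by (simp add: minus_eq M.r_neg del: M.l_zero)
  from W[OF this] obtain V V' where V: "openin T V" "openin T V'" "\<zero>\<^bsub>M\<^esub> \<in> V" "\<zero>\<^bsub>M\<^esub> \<in> V'" "V \<times> V' \<subseteq> ?W"
    by blast
  have shift: "continuous_map T T (\<lambda>z. z \<ominus>\<^bsub>M\<^esub> w)" if "w \<in> carrier M" for w
  proof -
    have "continuous_map T (prod_topology T T) (\<lambda>z. (z, w))"
      using that tT by (intro continuous_map_pairedI) auto
    from continuous_map_compose[OF this minus] show ?thesis by (simp add: comp_def)
  qed
  show "\<exists>P Q. openin T P \<and> openin T Q \<and> x \<in> P \<and> y \<in> Q \<and> disjnt P Q"
  \<comment> \<open>The separating sets are the translates x + V' and y + V, written as preimages
    under shifts.\<close>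
  proof (intro exI conjI)
    show "openin T {z \<in> topspace T. z \<ominus>\<^bsub>M\<^esub> x \<in> V'}" "openin T {z \<in> topspace T. z \<ominus>\<^bsub>M\<^esub> y \<in> V}"
      by (rule openin_continuous_map_preimage[OF shift V(2)] openin_continuous_map_preimage[OF shift V(1)],
          use xy tT in blast)+
    show "x \<in> {z \<in> topspace T. z \<ominus>\<^bsub>M\<^esub> x \<in> V'}" "y \<in> {z \<in> topspace T. z \<ominus>\<^bsub>M\<^esub> y \<in> V}"
      using xy tT V by (auto simp: minus_eq M.r_neg)
    have False if z: "z \<in> carrier M" "z \<ominus>\<^bsub>M\<^esub> x \<in> V'" "z \<ominus>\<^bsub>M\<^esub> y \<in> V" for z
    proof -
      \<comment> \<open>A common point z exhibits x - y as an element of V - V', hence of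
        \<open>U\<close>.\<close>
      have "(z \<ominus>\<^bsub>M\<^esub> y) \<ominus>\<^bsub>M\<^esub> (z \<ominus>\<^bsub>M\<^esub> x) \<in> U"
        using V(5) z by auto
      moreover have "(z \<ominus>\<^bsub>M\<^esub> y) \<ominus>\<^bsub>M\<^esub> (z \<ominus>\<^bsub>M\<^esub> x) = x \<ominus>\<^bsub>M\<^esub> y"
      proof -
        have c: "x \<in> carrier M" "y \<in> carrier M" using xy tT by auto
        have "(z \<ominus>\<^bsub>M\<^esub> y) \<ominus>\<^bsub>M\<^esub> (z \<ominus>\<^bsub>M\<^esub> x) = (z \<oplus>\<^bsub>M\<^esub> \<ominus>\<^bsub>M\<^esub> y) \<oplus>\<^bsub>M\<^esub> (\<ominus>\<^bsub>M\<^esub> z \<oplus>\<^bsub>M\<^esub> x)"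
          using c z by (simp add: minus_eq M.minus_add)
        also have "\<dots> = (z \<oplus>\<^bsub>M\<^esub> \<ominus>\<^bsub>M\<^esub> z) \<oplus>\<^bsub>M\<^esub> (x \<oplus>\<^bsub>M\<^esub> \<ominus>\<^bsub>M\<^esub> y)"
          using c z by (simp add: M.a_ac)
        finally show ?thesis
          using c z by (simp add: M.r_neg minus_eq)
      qed
      ultimately show False using U(3) by simp
    qed
    then show "disjnt {z \<in> topspace T. z \<ominus>\<^bsub>M\<^esub> x \<in> V'} {z \<in> topspace T. z \<ominus>\<^bsub>M\<^esub> y \<in> V}"
      using tT by (auto simp: disjnt_iff)
  qed
qed

section \<open>Extension of scalars\<close>

text \<open>Stated for functions additive on the carrier, so that it applies both to the tensor map
  in its second argument and to the extended coordinate functionals.\<close>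

lemma finsum_additive:
  assumes G: "abelian_group G" and H: "abelian_group H"
    and closed: "h \<in> carrier G \<rightarrow> carrier H"
    and add: "\<And>x y. x \<in> carrier G \<Longrightarrow> y \<in> carrier G \<Longrightarrow> h (x \<oplus>\<^bsub>G\<^esub> y) = h x \<oplus>\<^bsub>H\<^esub> h y"
    and "finite F" "f \<in> F \<rightarrow> carrier G"
  shows "h (finsum G f F) = finsum H (\<lambda>i. h (f i)) F"
  using assms(5,6)
proof (induction F rule: finite_induct)
  interpret G: abelian_group G by (rule G)
  interpret H: abelian_group H by (rule H)
  case empty
  \<comment> \<open>The image of zero is idempotent under addition, so cancellation makes it
    zero.\<close>
  have "h \<zero>\<^bsub>G\<^esub> \<oplus>\<^bsub>H\<^esub> h \<zero>\<^bsub>G\<^esub> = h \<zero>\<^bsub>G\<^esub>" "h \<zero>\<^bsub>G\<^esub> \<in> carrier H"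
    using add[of "\<zero>\<^bsub>G\<^esub>" "\<zero>\<^bsub>G\<^esub>"] closed by auto
  then show ?case using H.add.r_cancel_one by simp
next
  interpret G: abelian_group G by (rule G)
  interpret H: abelian_group H by (rule H)
  case (insert i F)
  then have "h (f i) \<in> carrier H" "(\<lambda>i. h (f i)) \<in> F \<rightarrow> carrier H" "f \<in> F \<rightarrow> carrier G" "f i \<in> carrier G"
    using closed by auto
  then show ?case using insert by (simp add: add)
qed

text \<open>The tensor product is developed for any homomorphism of commutative rings; the
  completion is substituted only in the final theorem.\<close>

locale scalar_extension = Module.module K X + L: cring L
  for K (structure) and X (structure) and L (structure) +
  fixes \<iota>
  assumes hom: "\<iota> \<in> ring_hom K L"
begin

abbreviation (input) "G \<equiv> tensor_group L X"
abbreviation (input) "N \<equiv> tensor_null K L \<iota> X"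
abbreviation (input) "E \<equiv> extend_scalars K L \<iota> X"
abbreviation (input) "tens \<equiv> tensor K L \<iota> X"

lemma \<iota>_closed [simp]: "a \<in> carrier K \<Longrightarrow> \<iota> a \<in> carrier L"
  using ring_hom_closed[OF hom] .

section \<open>The free abelian group and its subgroup of relations\<close>

lemma comm_group_tensor_group: "comm_group G"
  unfolding tensor_group_def by (rule abelian_free_Abelian_group)

lemma tensor_carrier_add: "p \<in> carrier G \<Longrightarrow> q \<in> carrier G \<Longrightarrow> p + q \<in> carrier G"
  and tensor_carrier_diff: "p \<in> carrier G \<Longrightarrow> q \<in> carrier G \<Longrightarrow> p - q \<in> carrier G"
  and tensor_carrier_0: "0 \<in> carrier G"
  unfolding tensor_group_def carrier_free_Abelian_group_iff
  using keys_add[of p q] keys_diff[of p q] by auto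

lemma tensor_carrier_uminus: "p \<in> carrier G \<Longrightarrow> - p \<in> carrier G"
  by (simp add: tensor_group_def)

lemma frag_of_tensor_carrier [simp]:
  "frag_of (c, x) \<in> carrier G \<longleftrightarrow> c \<in> carrier L \<and> x \<in> carrier X"
  unfolding tensor_group_def by simp

lemma tensor_relations_subset: "tensor_relations K L \<iota> X \<subseteq> carrier G"
  unfolding tensor_relations_def by (auto intro!: tensor_carrier_diff)

lemma subgroup_tensor_null: "subgroup N G"
  unfolding tensor_null_def
  by (intro group.generate_is_subgroup tensor_relations_subset comm_group.axioms(2)[OF comm_group_tensor_group])

lemma tensor_null_0: "0 \<in> N"
  using subgroup.one_closed[OF subgroup_tensor_null] by (simp add: tensor_group_def)

lemma tensor_null_add: "p \<in> N \<Longrightarrow> q \<in> N \<Longrightarrow> p + q \<in> N"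
  using subgroup.m_closed[OF subgroup_tensor_null, of p q] by (simp add: tensor_group_def)

lemma tensor_null_carrier: "p \<in> N \<Longrightarrow> p \<in> carrier G"
  using subgroup.mem_carrier[OF subgroup_tensor_null] .

lemma tensor_null_uminus: "p \<in> N \<Longrightarrow> - p \<in> N"
  using subgroup.m_inv_closed[OF subgroup_tensor_null, of p] tensor_null_carrier[of p]
  by (simp add: tensor_group_def)

lemma tensor_null_diff: "p \<in> N \<Longrightarrow> q \<in> N \<Longrightarrow> p - q \<in> N"
  using tensor_null_add[OF _ tensor_null_uminus, of p q] by simp

lemma tensor_group_induct [consumes 1, case_names zero frag diff]:
  assumes "p \<in> carrier G" "P 0"
    and "\<And>c x. c \<in> carrier L \<Longrightarrow> x \<in> carrier X \<Longrightarrow> P (frag_of (c, x))"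
    and "\<And>p q. p \<in> carrier G \<Longrightarrow> q \<in> carrier G \<Longrightarrow> P p \<Longrightarrow> P q \<Longrightarrow> P (p - q)"
  shows "P p"
  using assms(1) unfolding tensor_group_def carrier_free_Abelian_group_iff
  by (rule free_Abelian_group_induct) (use assms in \<open>auto simp: tensor_group_def\<close>)

section \<open>Classes modulo the relations\<close>

definition tclass where "tclass p = N #>\<^bsub>G\<^esub> p"

lemma tensor_eq: "tens c x = tclass (frag_of (c, x))"
  by (simp add: tensor_def tclass_def)

lemma mem_tclass_iff: "q \<in> tclass p \<longleftrightarrow> q - p \<in> N"
proof -
  have "q \<in> tclass p \<longleftrightarrow> (\<exists>n\<in>N. q = n + p)"
    by (simp add: tclass_def r_coset_def tensor_group_def)
  also have "\<dots> \<longleftrightarrow> q - p \<in> N" by (auto intro!: bexI[of _ "q - p"])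
  finally show ?thesis .
qed

lemma tclass_eq_iff: "tclass p = tclass q \<longleftrightarrow> p - q \<in> N"
proof
  assume "tclass p = tclass q"
  moreover have "p \<in> tclass p" by (simp add: mem_tclass_iff tensor_null_0)
  ultimately show "p - q \<in> N" by (simp add: mem_tclass_iff)
next
  assume pq: "p - q \<in> N"
  have "r - p \<in> N \<longleftrightarrow> r - q \<in> N" for r
    using tensor_null_add[OF _ pq, of "r - p"] tensor_null_diff[OF _ pq, of "r - q"]
    by (auto simp: algebra_simps)
  then show "tclass p = tclass q" by (auto simp: mem_tclass_iff)
qed

lemma extend_scalars_carrier: "carrier E = tclass ` carrier G"
  by (auto simp: extend_scalars_def Let_def FactGroup_def RCOSETS_def tclass_def)

lemma tclass_closed [simp]: "p \<in> carrier G \<Longrightarrow> tclass p \<in> carrier E"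
  by (simp add: extend_scalars_carrier)

lemma extend_scalars_cases:
  assumes "z \<in> carrier E"
  obtains p where "p \<in> carrier G" "z = tclass p"
  using assms by (auto simp: extend_scalars_carrier)

lemma extend_scalars_zero: "\<zero>\<^bsub>E\<^esub> = tclass 0"
  unfolding extend_scalars_def Let_def FactGroup_def
  by (auto simp: mem_tclass_iff)

lemma tclass_add:
  assumes "p \<in> carrier G" "q \<in> carrier G"
  shows "tclass p \<oplus>\<^bsub>E\<^esub> tclass q = tclass (p + q)"
proof -
  have "N \<lhd> G"
    by (intro comm_group.subgroup_imp_normal comm_group_tensor_group subgroup_tensor_null)
  from normal.rcos_sum[OF this assms] show ?thesis
    unfolding extend_scalars_def Let_def FactGroup_def tclass_def by (simp add: tensor_group_def)
qed

section \<open>The scalar action\<close>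

definition tscale where "tscale c = frag_extend (\<lambda>(d, x). frag_of (c \<otimes>\<^bsub>L\<^esub> d, x))"

lemma tscale_simps [simp]:
  "tscale c 0 = 0" "tscale c (frag_of (d, x)) = frag_of (c \<otimes>\<^bsub>L\<^esub> d, x)"
  "tscale c (p + q) = tscale c p + tscale c q" "tscale c (p - q) = tscale c p - tscale c q"
  "tscale c (- p) = - tscale c p"
  by (simp_all add: tscale_def frag_extend_add frag_extend_diff frag_extend_minus)

lemma tscale_closed:
  assumes "c \<in> carrier L" "p \<in> carrier G"
  shows "tscale c p \<in> carrier G"
  using assms(2)
  by (induction p rule: tensor_group_induct)
    (use assms(1) in \<open>simp_all add: tensor_carrier_0 tensor_carrier_diff\<close>)

lemma frag_relation_add_left:
  "c \<in> carrier L \<Longrightarrow> d \<in> carrier L \<Longrightarrow> x \<in> carrier X \<Longrightarrow>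
    frag_of (c \<oplus>\<^bsub>L\<^esub> d, x) - frag_of (c, x) - frag_of (d, x) \<in> N"
  unfolding tensor_null_def by (rule generate.incl) (auto simp: tensor_relations_def)

lemma frag_relation_add_right:
  "c \<in> carrier L \<Longrightarrow> x \<in> carrier X \<Longrightarrow> y \<in> carrier X \<Longrightarrow>
    frag_of (c, x \<oplus>\<^bsub>X\<^esub> y) - frag_of (c, x) - frag_of (c, y) \<in> N"
  unfolding tensor_null_def by (rule generate.incl) (auto simp: tensor_relations_def)

lemma frag_relation_smult:
  "c \<in> carrier L \<Longrightarrow> a \<in> carrier K \<Longrightarrow> x \<in> carrier X \<Longrightarrow>
    frag_of (c \<otimes>\<^bsub>L\<^esub> \<iota> a, x) - frag_of (c, a \<odot>\<^bsub>X\<^esub> x) \<in> N"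
  unfolding tensor_null_def by (rule generate.incl) (auto simp: tensor_relations_def)

text \<open>Induction over the generated subgroup in additive notation, with one case for each kind
  of tensor relation.\<close>

lemma tensor_null_induct [consumes 1, case_names zero add_left add_right smult uminus add]:
  assumes p: "p \<in> N" and "P 0"
    and al: "\<And>c d x. c \<in> carrier L \<Longrightarrow> d \<in> carrier L \<Longrightarrow> x \<in> carrier X \<Longrightarrow>
      P (frag_of (c \<oplus>\<^bsub>L\<^esub> d, x) - frag_of (c, x) - frag_of (d, x))"
    and ar: "\<And>c x y. c \<in> carrier L \<Longrightarrow> x \<in> carrier X \<Longrightarrow> y \<in> carrier X \<Longrightarrow>
      P (frag_of (c, x \<oplus>\<^bsub>X\<^esub> y) - frag_of (c, x) - frag_of (c, y))"
    and sm: "\<And>c a x. c \<in> carrier L \<Longrightarrow> a \<in> carrier K \<Longrightarrow> x \<in> carrier X \<Longrightarrow>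
      P (frag_of (c \<otimes>\<^bsub>L\<^esub> \<iota> a, x) - frag_of (c, a \<odot>\<^bsub>X\<^esub> x))"
    and um: "\<And>p. p \<in> carrier G \<Longrightarrow> P p \<Longrightarrow> P (- p)"
    and ad: "\<And>p q. p \<in> carrier G \<Longrightarrow> q \<in> carrier G \<Longrightarrow> P p \<Longrightarrow> P q \<Longrightarrow> P (p + q)"
  shows "P p"
proof -
  have rel: "P r" if "r \<in> tensor_relations K L \<iota> X" for r
    using that unfolding tensor_relations_def Un_iff mem_Collect_eq
    by (elim disjE exE conjE) (simp_all add: al ar sm)
  from p have "p \<in> generate G (tensor_relations K L \<iota> X)" by (simp add: tensor_null_def)
  \<comment> \<open>Membership in \<open>N\<close> is carried along because the case
    \<open>ad\<close> demands that both summands lie in the carrier.\<close>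
  then have "p \<in> N \<and> P p"
  proof (induction rule: generate.induct)
    case one
    then show ?case using \<open>P 0\<close> tensor_null_0 by (simp add: tensor_group_def)
  next
    case (incl h)
    then show ?case using rel by (simp add: tensor_null_def generate.incl)
  next
    case (inv h)
    then have h: "h \<in> carrier G" "h \<in> N" "P h"
      using tensor_relations_subset rel by (auto simp: tensor_null_def generate.incl)
    then have "inv\<^bsub>G\<^esub> h = - h" by (simp add: tensor_group_def)
    then show ?case using h um tensor_null_uminus by simp
  next
    case (eng g h)
    then have "g + h \<in> N \<and> P (g + h)"
      by (auto intro!: tensor_null_add ad tensor_null_carrier)
    then show ?case by (simp add: tensor_group_def)
  qed
  then show ?thesis by simp
qed

text \<open>Scaling the left factors sends each relation to a relation of the same kind, by
  distributivity and associativity in \<open>L\<close>. Hence the scalar action is well defined on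
  classes.\<close>

lemma tscale_null:
  assumes c: "c \<in> carrier L" and p: "p \<in> N"
  shows "tscale c p \<in> N"
  using p
proof (induction p rule: tensor_null_induct)
  case (add_left d e x)
  then show ?case
    using c frag_relation_add_left[of "c \<otimes>\<^bsub>L\<^esub> d" "c \<otimes>\<^bsub>L\<^esub> e" x] by (simp add: L.r_distr)
next
  case (smult d a x)
  then show ?case
    using c frag_relation_smult[of "c \<otimes>\<^bsub>L\<^esub> d" a x] by (simp add: L.m_assoc)
qed (use c in \<open>simp_all add: tensor_null_0 tensor_null_add tensor_null_uminus frag_relation_add_right\<close>)

text \<open>By \<open>tscale_null\<close> every representative contributes the same class, so the
  union defining the scalar action collapses to that class.\<close>

lemma smult_tclass:
  assumes "c \<in> carrier L" "p \<in> carrier G"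
  shows "c \<odot>\<^bsub>E\<^esub> tclass p = tclass (tscale c p)"
proof -
  have "c \<odot>\<^bsub>E\<^esub> tclass p = (\<Union>q\<in>tclass p. tclass (tscale c q))"
    by (simp add: extend_scalars_def Let_def tclass_def tscale_def)
  also have "\<dots> = (\<Union>q\<in>tclass p. tclass (tscale c p))"
  proof (intro SUP_cong refl)
    fix q assume "q \<in> tclass p"
    then show "tclass (tscale c q) = tclass (tscale c p)"
      using tscale_null[OF assms(1), of "q - p"] by (simp add: mem_tclass_iff tclass_eq_iff)
  qed
  also have "\<dots> = tclass (tscale c p)"
    using mem_tclass_iff[of p p] tensor_null_0 by auto
  finally show ?thesis .
qed

theorem module_extend_scalars: "Module.module L E"
proof (rule moduleI)
  show "cring L" by unfold_locales
  show "abelian_group E"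
  proof (rule abelian_groupI)
    fix x assume "x \<in> carrier E"
    then obtain p where p: "p \<in> carrier G" "x = tclass p" by (rule extend_scalars_cases)
    show "\<zero>\<^bsub>E\<^esub> \<oplus>\<^bsub>E\<^esub> x = x"
      using p by (simp add: extend_scalars_zero tclass_add tensor_carrier_0)
    show "\<exists>y\<in>carrier E. y \<oplus>\<^bsub>E\<^esub> x = \<zero>\<^bsub>E\<^esub>"
      using p by (intro bexI[of _ "tclass (- p)"])
        (simp_all add: extend_scalars_zero tclass_add tensor_carrier_uminus)
    fix y assume "y \<in> carrier E"
    then obtain q where q: "q \<in> carrier G" "y = tclass q" by (rule extend_scalars_cases)
    show "x \<oplus>\<^bsub>E\<^esub> y \<in> carrier E" "x \<oplus>\<^bsub>E\<^esub> y = y \<oplus>\<^bsub>E\<^esub> x"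
      using p q by (simp_all add: tclass_add tensor_carrier_add add.commute)
    fix z assume "z \<in> carrier E"
    then obtain r where r: "r \<in> carrier G" "z = tclass r" by (rule extend_scalars_cases)
    show "x \<oplus>\<^bsub>E\<^esub> y \<oplus>\<^bsub>E\<^esub> z = x \<oplus>\<^bsub>E\<^esub> (y \<oplus>\<^bsub>E\<^esub> z)"
      using p q r by (simp add: tclass_add tensor_carrier_add add.assoc)
  qed (simp add: extend_scalars_zero tensor_carrier_0)
  fix c z assume c: "c \<in> carrier L" and z: "z \<in> carrier E"
  obtain p where p: "p \<in> carrier G" "z = tclass p" using z by (rule extend_scalars_cases)
  show "c \<odot>\<^bsub>E\<^esub> z \<in> carrier E"
    using c p by (simp add: smult_tclass tscale_closed)
  fix d assume d: "d \<in> carrier L"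
  \<comment> \<open>The other axioms hold already for formal sums; this distributive law is obtained
    only modulo the relations, from additivity in the left factor.\<close>
  have "tscale (c \<oplus>\<^bsub>L\<^esub> d) p - (tscale c p + tscale d p) \<in> N"
    using p(1)
  proof (induction p rule: tensor_group_induct)
    case (frag e x)
    then show ?case
      using c d frag_relation_add_left[of "c \<otimes>\<^bsub>L\<^esub> e" "d \<otimes>\<^bsub>L\<^esub> e" x]
      by (simp add: L.l_distr diff_diff_eq)
  next
    case (diff p q)
    from tensor_null_diff[OF diff(3,4)] show ?case by (simp add: algebra_simps)
  qed (simp add: tensor_null_0)
  then show "(c \<oplus>\<^bsub>L\<^esub> d) \<odot>\<^bsub>E\<^esub> z = c \<odot>\<^bsub>E\<^esub> z \<oplus>\<^bsub>E\<^esub> d \<odot>\<^bsub>E\<^esub> z"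
    using c d p by (simp add: smult_tclass tclass_add tscale_closed tclass_eq_iff)
  have "tscale (c \<otimes>\<^bsub>L\<^esub> d) p = tscale c (tscale d p)"
    using p(1)
    by (induction p rule: tensor_group_induct) (use c d in \<open>simp_all add: L.m_assoc\<close>)
  then show "(c \<otimes>\<^bsub>L\<^esub> d) \<odot>\<^bsub>E\<^esub> z = c \<odot>\<^bsub>E\<^esub> (d \<odot>\<^bsub>E\<^esub> z)"
    using c d p by (simp add: smult_tclass tscale_closed)
next
  fix c z w assume c: "c \<in> carrier L" and "z \<in> carrier E" "w \<in> carrier E"
  from this(2,3) obtain p q where "p \<in> carrier G" "z = tclass p" "q \<in> carrier G" "w = tclass q"
    by (elim extend_scalars_cases)
  then show "c \<odot>\<^bsub>E\<^esub> (z \<oplus>\<^bsub>E\<^esub> w) = c \<odot>\<^bsub>E\<^esub> z \<oplus>\<^bsub>E\<^esub> c \<odot>\<^bsub>E\<^esub> w"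
    using c by (simp add: smult_tclass tclass_add tscale_closed tensor_carrier_add)
next
  fix z assume "z \<in> carrier E"
  then obtain p where p: "p \<in> carrier G" "z = tclass p" by (rule extend_scalars_cases)
  have "tscale \<one>\<^bsub>L\<^esub> p = p"
    using p(1) by (induction p rule: tensor_group_induct) simp_all
  then show "\<one>\<^bsub>L\<^esub> \<odot>\<^bsub>E\<^esub> z = z"
    using p by (simp add: smult_tclass)
qed

sublocale E: Module.module L E
  by (rule module_extend_scalars)

lemma tensor_closed: "c \<in> carrier L \<Longrightarrow> x \<in> carrier X \<Longrightarrow> tens c x \<in> carrier E"
  by (simp add: tensor_eq)

lemma smult_tensor:
  "c \<in> carrier L \<Longrightarrow> d \<in> carrier L \<Longrightarrow> x \<in> carrier X \<Longrightarrow> c \<odot>\<^bsub>E\<^esub> tens d x = tens (c \<otimes>\<^bsub>L\<^esub> d) x"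
  by (simp add: tensor_eq smult_tclass)

lemma tensor_add_right:
  assumes "c \<in> carrier L" "x \<in> carrier X" "y \<in> carrier X"
  shows "tens c (x \<oplus>\<^bsub>X\<^esub> y) = tens c x \<oplus>\<^bsub>E\<^esub> tens c y"
  using frag_relation_add_right[OF assms] assms
  by (simp add: tensor_eq tclass_add tclass_eq_iff diff_diff_eq)

lemma tensor_smult_right:
  assumes "c \<in> carrier L" "a \<in> carrier K" "x \<in> carrier X"
  shows "tens c (a \<odot>\<^bsub>X\<^esub> x) = tens (c \<otimes>\<^bsub>L\<^esub> \<iota> a) x"
  using tensor_null_uminus[OF frag_relation_smult[OF assms]] assms
  by (simp add: tensor_eq tclass_eq_iff)

text \<open>This is the universal property of the tensor product for the balanced map sending (c, x)
  to c times \<open>\<iota> (\<phi> x)\<close>. It is applied to the coordinate functionals of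
  X.\<close>

lemma extend_functional:
  assumes closed: "\<phi> \<in> carrier X \<rightarrow> carrier K"
    and add: "\<And>x y. x \<in> carrier X \<Longrightarrow> y \<in> carrier X \<Longrightarrow> \<phi> (x \<oplus>\<^bsub>X\<^esub> y) = \<phi> x \<oplus>\<^bsub>K\<^esub> \<phi> y"
    and smult: "\<And>a x. a \<in> carrier K \<Longrightarrow> x \<in> carrier X \<Longrightarrow> \<phi> (a \<odot>\<^bsub>X\<^esub> x) = a \<otimes>\<^bsub>K\<^esub> \<phi> x"
  obtains h where "h \<in> carrier E \<rightarrow> carrier L"
    and "\<And>z w. z \<in> carrier E \<Longrightarrow> w \<in> carrier E \<Longrightarrow> h (z \<oplus>\<^bsub>E\<^esub> w) = h z \<oplus>\<^bsub>L\<^esub> h w"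
    and "\<And>c z. c \<in> carrier L \<Longrightarrow> z \<in> carrier E \<Longrightarrow> h (c \<odot>\<^bsub>E\<^esub> z) = c \<otimes>\<^bsub>L\<^esub> h z"
    and "\<And>c x. c \<in> carrier L \<Longrightarrow> x \<in> carrier X \<Longrightarrow> h (tens c x) = c \<otimes>\<^bsub>L\<^esub> \<iota> (\<phi> x)"
proof -
  have \<phi>: "\<phi> x \<in> carrier K" if "x \<in> carrier X" for x using closed that by blast
  define f where "f p = fst p \<otimes>\<^bsub>L\<^esub> \<iota> (\<phi> (snd p))" for p
  have f: "f ` (carrier L \<times> carrier X) \<subseteq> carrier (add_monoid L)"
    using \<phi> by (auto simp: f_def)
  obtain g where "g \<in> hom (free_Abelian_group (carrier L \<times> carrier X)) (add_monoid L)"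
    and gf: "\<And>p. p \<in> carrier L \<times> carrier X \<Longrightarrow> g (frag_of p) = f p"
    \<comment> \<open>The values \<open>f\<close> prescribed on the generating pairs extend uniquely
      to a group homomorphism.\<close>
    by (rule comm_group.free_Abelian_group_universal[OF L.a_comm_group f], rule that) blast+
  then have g: "g \<in> hom G (add_monoid L)" by (simp add: tensor_group_def)
  have g_frag: "g (frag_of (c, x)) = c \<otimes>\<^bsub>L\<^esub> \<iota> (\<phi> x)" if "c \<in> carrier L" "x \<in> carrier X" for c x
    using gf[of "(c, x)"] that by (simp add: f_def)
  interpret g: group_hom G "add_monoid L" g
    using g comm_group_tensor_group by (simp add: group_hom_def group_hom_axioms_def comm_group.axioms L.a_group)
  have gc: "g p \<in> carrier L" if "p \<in> carrier G" for p
    using g.hom_closed that by simp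
  have g0: "g 0 = \<zero>\<^bsub>L\<^esub>"
    using g.hom_one by (simp add: tensor_group_def)
  have gadd: "g (p + q) = g p \<oplus>\<^bsub>L\<^esub> g q" if "p \<in> carrier G" "q \<in> carrier G" for p q
    using g.hom_mult[OF that] by (simp add: tensor_group_def)
  have gum: "g (- p) = \<ominus>\<^bsub>L\<^esub> g p" if "p \<in> carrier G" for p
    using g.hom_inv[OF that] that by (simp add: tensor_group_def a_inv_def)
  have gdiff: "g (p - q) = g p \<ominus>\<^bsub>L\<^esub> g q" if "p \<in> carrier G" "q \<in> carrier G" for p q
    using gadd[OF that(1) tensor_carrier_uminus[OF that(2)]] gum[OF that(2)] by (simp add: a_minus_def)
  \<comment> \<open>The homomorphism kills the three kinds of relations because \<open>f\<close> is
    additive in each argument and balanced over \<open>K\<close>.\<close>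
  have g_null: "g p = \<zero>\<^bsub>L\<^esub>" if "p \<in> N" for p
    using that
  proof (induction p rule: tensor_null_induct)
    case (add_left c d x)
    then have "g (frag_of (c \<oplus>\<^bsub>L\<^esub> d, x) - frag_of (c, x) - frag_of (d, x)) =
        (c \<oplus>\<^bsub>L\<^esub> d) \<otimes>\<^bsub>L\<^esub> \<iota> (\<phi> x) \<ominus>\<^bsub>L\<^esub> c \<otimes>\<^bsub>L\<^esub> \<iota> (\<phi> x) \<ominus>\<^bsub>L\<^esub> d \<otimes>\<^bsub>L\<^esub> \<iota> (\<phi> x)"
      by (simp add: gdiff g_frag tensor_carrier_diff)
    also have "\<dots> = \<zero>\<^bsub>L\<^esub>"
    proof -
      have "\<iota> (\<phi> x) \<in> carrier L" using add_left \<phi> by simp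
      with add_left(1,2) show ?thesis by algebra
    qed
    finally show ?case .
  next
    case (add_right c x y)
    have \<iota>add: "\<iota> (\<phi> x \<oplus>\<^bsub>K\<^esub> \<phi> y) = \<iota> (\<phi> x) \<oplus>\<^bsub>L\<^esub> \<iota> (\<phi> y)"
      using add_right \<phi> by (intro ring_hom_add[OF hom]) auto
    from add_right have "g (frag_of (c, x \<oplus>\<^bsub>X\<^esub> y) - frag_of (c, x) - frag_of (c, y)) =
        c \<otimes>\<^bsub>L\<^esub> (\<iota> (\<phi> x) \<oplus>\<^bsub>L\<^esub> \<iota> (\<phi> y)) \<ominus>\<^bsub>L\<^esub> c \<otimes>\<^bsub>L\<^esub> \<iota> (\<phi> x) \<ominus>\<^bsub>L\<^esub> c \<otimes>\<^bsub>L\<^esub> \<iota> (\<phi> y)"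
      by (simp add: gdiff g_frag tensor_carrier_diff add \<iota>add)
    also have "\<dots> = \<zero>\<^bsub>L\<^esub>"
    proof -
      have "\<iota> (\<phi> x) \<in> carrier L" "\<iota> (\<phi> y) \<in> carrier L" using add_right \<phi> by auto
      with add_right(1) show ?thesis by algebra
    qed
    finally show ?case .
  next
    case (smult c a x)
    have "\<iota> (a \<otimes>\<^bsub>K\<^esub> \<phi> x) = \<iota> a \<otimes>\<^bsub>L\<^esub> \<iota> (\<phi> x)"
      using smult \<phi> by (intro ring_hom_mult[OF hom]) auto
    then show ?case
      using smult assms(3)[of a x] \<phi>
      by (simp add: gdiff g_frag L.m_assoc a_minus_def L.r_neg)
  next
    case (uminus p)
    then show ?case by (simp add: gum)
  next
    case (add p q)
    then show ?case by (simp add: gadd)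
  qed (rule g0)
  \<comment> \<open>The value is read off a chosen representative; \<open>g_null\<close> makes it
    independent of the choice.\<close>
  define h where "h z = g (SOME p. p \<in> carrier G \<and> z = tclass p)" for z
  have h: "h (tclass p) = g p" if p: "p \<in> carrier G" for p
  proof -
    define q where "q = (SOME q. q \<in> carrier G \<and> tclass p = tclass q)"
    have q: "q \<in> carrier G" "tclass p = tclass q"
      using someI[of "\<lambda>q. q \<in> carrier G \<and> tclass p = tclass q" p] p unfolding q_def by auto
    then have "p - q \<in> N" by (simp add: tclass_eq_iff)
    then have "g (p - q) = \<zero>\<^bsub>L\<^esub>" by (rule g_null)
    then have "g p = g q"
      using gadd[of "p - q" q] p q gc by (simp add: tensor_carrier_diff)
    then show ?thesis unfolding h_def q_def by simp
  qed
  show thesis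
  proof (rule that[of h])
    show "h \<in> carrier E \<rightarrow> carrier L"
      using h gc by (auto simp: extend_scalars_carrier)
    show "h (z \<oplus>\<^bsub>E\<^esub> w) = h z \<oplus>\<^bsub>L\<^esub> h w" if zw: "z \<in> carrier E" "w \<in> carrier E" for z w
    proof -
      obtain p where p: "p \<in> carrier G" "z = tclass p" using zw(1) by (rule extend_scalars_cases)
      obtain q where q: "q \<in> carrier G" "w = tclass q" using zw(2) by (rule extend_scalars_cases)
      show ?thesis using p q by (simp add: tclass_add h gadd tensor_carrier_add)
    qed
    show "h (c \<odot>\<^bsub>E\<^esub> z) = c \<otimes>\<^bsub>L\<^esub> h z" if c: "c \<in> carrier L" and z: "z \<in> carrier E" for c z
    proof -
      obtain p where p: "p \<in> carrier G" "z = tclass p" using z by (rule extend_scalars_cases)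
      have "g (tscale c p) = c \<otimes>\<^bsub>L\<^esub> g p"
        using p(1)
      proof (induction p rule: tensor_group_induct)
        case zero
        then show ?case using c by (simp add: g0)
      next
        case (frag d x)
        then show ?case using c \<phi> by (simp add: g_frag L.m_assoc)
      next
        case (diff p q)
        then show ?case
          using c gc by (simp add: gdiff tscale_closed a_minus_def L.r_distr L.r_minus)
      qed
      then show ?thesis using c p by (simp add: smult_tclass h tscale_closed)
    qed
    show "h (tens c x) = c \<otimes>\<^bsub>L\<^esub> \<iota> (\<phi> x)" if "c \<in> carrier L" "x \<in> carrier X" for c x
      using that by (simp add: tensor_eq h g_frag)
  qed
qed

end

section \<open>Bases under extension of scalars\<close>

locale based_scalar_extension =
  scalar_extension K X L \<iota> + based_module K X B
  for K (structure) and X (structure) and L (structure) and \<iota> and B +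
  assumes one_neq_zero: "\<one>\<^bsub>L\<^esub> \<noteq> \<zero>\<^bsub>L\<^esub>"
begin

abbreviation (input) "emb \<equiv> tensor K L \<iota> X \<one>\<^bsub>L\<^esub>"

lemma emb_closed: "x \<in> carrier X \<Longrightarrow> emb x \<in> carrier E"
  by (simp add: tensor_closed)

text \<open>This is the coordinate functional at \<open>b\<close> after extension of scalars, chosen
  from those supplied by \<open>extend_functional\<close>; the last clause fixes it on pure
  tensors.\<close>

definition ext_coord where
  "ext_coord b = (SOME h. h \<in> carrier E \<rightarrow> carrier L \<and>
     (\<forall>z\<in>carrier E. \<forall>w\<in>carrier E. h (z \<oplus>\<^bsub>E\<^esub> w) = h z \<oplus>\<^bsub>L\<^esub> h w) \<and>
     (\<forall>c\<in>carrier L. \<forall>z\<in>carrier E. h (c \<odot>\<^bsub>E\<^esub> z) = c \<otimes>\<^bsub>L\<^esub> h z) \<and>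
     (\<forall>c\<in>carrier L. \<forall>x\<in>carrier X. h (tens c x) = c \<otimes>\<^bsub>L\<^esub> \<iota> (coord x b)))"

lemma
  assumes b: "b \<in> B"
  shows ext_coord_closed: "z \<in> carrier E \<Longrightarrow> ext_coord b z \<in> carrier L"
    and ext_coord_add: "z \<in> carrier E \<Longrightarrow> w \<in> carrier E \<Longrightarrow>
      ext_coord b (z \<oplus>\<^bsub>E\<^esub> w) = ext_coord b z \<oplus>\<^bsub>L\<^esub> ext_coord b w"
    and ext_coord_smult: "c \<in> carrier L \<Longrightarrow> z \<in> carrier E \<Longrightarrow> ext_coord b (c \<odot>\<^bsub>E\<^esub> z) = c \<otimes>\<^bsub>L\<^esub> ext_coord b z"
    and ext_coord_tensor: "c \<in> carrier L \<Longrightarrow> x \<in> carrier X \<Longrightarrow> ext_coord b (tens c x) = c \<otimes>\<^bsub>L\<^esub> \<iota> (coord x b)"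
proof -
  let ?P = "\<lambda>h. h \<in> carrier E \<rightarrow> carrier L \<and>
     (\<forall>z\<in>carrier E. \<forall>w\<in>carrier E. h (z \<oplus>\<^bsub>E\<^esub> w) = h z \<oplus>\<^bsub>L\<^esub> h w) \<and>
     (\<forall>c\<in>carrier L. \<forall>z\<in>carrier E. h (c \<odot>\<^bsub>E\<^esub> z) = c \<otimes>\<^bsub>L\<^esub> h z) \<and>
     (\<forall>c\<in>carrier L. \<forall>x\<in>carrier X. h (tens c x) = c \<otimes>\<^bsub>L\<^esub> \<iota> (coord x b))"
  have "\<exists>h. ?P h"
  proof (rule extend_functional[of "\<lambda>x. coord x b"])
    show "(\<lambda>x. coord x b) \<in> carrier X \<rightarrow> carrier K" using b by auto
    show "coord (x \<oplus>\<^bsub>X\<^esub> y) b = coord x b \<oplus>\<^bsub>K\<^esub> coord y b" if "x \<in> carrier X" "y \<in> carrier X" for x y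
      using that b by (rule coord_add)
    show "coord (a \<odot>\<^bsub>X\<^esub> x) b = a \<otimes>\<^bsub>K\<^esub> coord x b" if "a \<in> carrier K" "x \<in> carrier X" for a x
      using that b by (intro coord_smult)
    show "\<exists>h. ?P h" if "h \<in> carrier E \<rightarrow> carrier L"
      "\<And>z w. z \<in> carrier E \<Longrightarrow> w \<in> carrier E \<Longrightarrow> h (z \<oplus>\<^bsub>E\<^esub> w) = h z \<oplus>\<^bsub>L\<^esub> h w"
      "\<And>c z. c \<in> carrier L \<Longrightarrow> z \<in> carrier E \<Longrightarrow> h (c \<odot>\<^bsub>E\<^esub> z) = c \<otimes>\<^bsub>L\<^esub> h z"
      "\<And>c x. c \<in> carrier L \<Longrightarrow> x \<in> carrier X \<Longrightarrow> h (tens c x) = c \<otimes>\<^bsub>L\<^esub> \<iota> (coord x b)" for h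
      using that by (intro exI[of _ h] conjI ballI) simp_all
  qed
  from someI_ex[OF this] have P: "?P (ext_coord b)"
    unfolding ext_coord_def .
  show "z \<in> carrier E \<Longrightarrow> ext_coord b z \<in> carrier L"
    "z \<in> carrier E \<Longrightarrow> w \<in> carrier E \<Longrightarrow> ext_coord b (z \<oplus>\<^bsub>E\<^esub> w) = ext_coord b z \<oplus>\<^bsub>L\<^esub> ext_coord b w"
    "c \<in> carrier L \<Longrightarrow> z \<in> carrier E \<Longrightarrow> ext_coord b (c \<odot>\<^bsub>E\<^esub> z) = c \<otimes>\<^bsub>L\<^esub> ext_coord b z"
    "c \<in> carrier L \<Longrightarrow> x \<in> carrier X \<Longrightarrow> ext_coord b (tens c x) = c \<otimes>\<^bsub>L\<^esub> \<iota> (coord x b)"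
    using P by blast+
qed

lemma ext_coord_emb: "b \<in> B \<Longrightarrow> x \<in> carrier X \<Longrightarrow> ext_coord b (emb x) = \<iota> (coord x b)"
  by (simp add: ext_coord_tensor)

text \<open>Additivity on the right splits the sum, and the balancing relation moves each
  coefficient to the left factor through \<iota>.\<close>

lemma tensor_lincomb:
  assumes c: "c \<in> carrier L" and a: "a \<in> B \<rightarrow> carrier K"
  shows "tens c (lincomb a) = (\<Oplus>\<^bsub>E\<^esub>b\<in>B. (c \<otimes>\<^bsub>L\<^esub> \<iota> (a b)) \<odot>\<^bsub>E\<^esub> emb b)"
proof -
  have "tens c (lincomb a) = (\<Oplus>\<^bsub>E\<^esub>b\<in>B. tens c (a b \<odot>\<^bsub>X\<^esub> b))"
    unfolding lincomb_def
    by (rule finsum_additive) (use c a finite_B in \<open>auto simp: tensor_closed tensor_add_right Pi_iff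
        M.abelian_group_axioms E.M.abelian_group_axioms\<close>)
  also have "\<dots> = (\<Oplus>\<^bsub>E\<^esub>b\<in>B. (c \<otimes>\<^bsub>L\<^esub> \<iota> (a b)) \<odot>\<^bsub>E\<^esub> emb b)"
    using c a by (intro E.M.finsum_cong')
      (auto simp: tensor_smult_right smult_tensor tensor_closed Pi_iff)
  finally show ?thesis .
qed

text \<open>Both sides are additive in \<open>z\<close>, so it suffices to treat pure tensors, where
  the claim is the basis expansion of the right factor.\<close>

lemma ext_coord_expansion:
  assumes "z \<in> carrier E"
  shows "(\<Oplus>\<^bsub>E\<^esub>b\<in>B. ext_coord b z \<odot>\<^bsub>E\<^esub> emb b) = z"
proof -
  define Q where "Q z = (\<Oplus>\<^bsub>E\<^esub>b\<in>B. ext_coord b z \<odot>\<^bsub>E\<^esub> emb b)" for z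
  have terms: "ext_coord b z \<odot>\<^bsub>E\<^esub> emb b \<in> carrier E" if "z \<in> carrier E" "b \<in> B" for z b
    using that by (simp add: ext_coord_closed emb_closed)
  have Q_closed: "Q z \<in> carrier E" if "z \<in> carrier E" for z
    unfolding Q_def using that by (intro E.M.finsum_closed) (simp add: terms)
  have Q_add: "Q (z \<oplus>\<^bsub>E\<^esub> w) = Q z \<oplus>\<^bsub>E\<^esub> Q w" if zw: "z \<in> carrier E" "w \<in> carrier E" for z w
  proof -
    have "Q (z \<oplus>\<^bsub>E\<^esub> w) = (\<Oplus>\<^bsub>E\<^esub>b\<in>B. ext_coord b z \<odot>\<^bsub>E\<^esub> emb b \<oplus>\<^bsub>E\<^esub> ext_coord b w \<odot>\<^bsub>E\<^esub> emb b)"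
      unfolding Q_def
      using zw by (intro E.M.finsum_cong')
        (auto simp: ext_coord_add ext_coord_closed emb_closed E.smult_l_distr)
    also have "\<dots> = Q z \<oplus>\<^bsub>E\<^esub> Q w"
      unfolding Q_def using zw terms by (intro E.M.finsum_addf) auto
    finally show ?thesis .
  qed
  obtain p where p: "p \<in> carrier G" "z = tclass p" using assms by (rule extend_scalars_cases)
  have "Q (tclass p) = tclass p"
    using p(1)
  proof (induction p rule: tensor_group_induct)
    case zero
    have "Q \<zero>\<^bsub>E\<^esub> \<oplus>\<^bsub>E\<^esub> Q \<zero>\<^bsub>E\<^esub> = Q \<zero>\<^bsub>E\<^esub>" "Q \<zero>\<^bsub>E\<^esub> \<in> carrier E"
      using Q_add[of "\<zero>\<^bsub>E\<^esub>" "\<zero>\<^bsub>E\<^esub>"] Q_closed by simp_all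
    then have "Q \<zero>\<^bsub>E\<^esub> = \<zero>\<^bsub>E\<^esub>" using E.M.add.r_cancel_one by simp
    then show ?case by (simp add: extend_scalars_zero)
  next
    case (frag c x)
    have "Q (tens c x) = (\<Oplus>\<^bsub>E\<^esub>b\<in>B. (c \<otimes>\<^bsub>L\<^esub> \<iota> (coord x b)) \<odot>\<^bsub>E\<^esub> emb b)"
      unfolding Q_def using frag by (intro E.M.finsum_cong') (auto simp: ext_coord_tensor emb_closed)
    also have "\<dots> = tens c (lincomb (coord x))"
      using frag coord_Pi by (simp add: tensor_lincomb)
    finally show ?case using frag by (simp add: lincomb_coord tensor_eq)
  next
    case (diff p q)
    \<comment> \<open>Differences are handled by adding q back and cancelling, since only additivity
      of \<open>Q\<close> is known.\<close>
    have "tclass (p - q) \<oplus>\<^bsub>E\<^esub> tclass q = tclass p"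
      using diff by (simp add: tclass_add tensor_carrier_diff)
    then have "Q (tclass (p - q)) \<oplus>\<^bsub>E\<^esub> tclass q = tclass (p - q) \<oplus>\<^bsub>E\<^esub> tclass q"
      using Q_add[of "tclass (p - q)" "tclass q"] diff by (simp add: tensor_carrier_diff)
    then show ?case
      using diff by (simp add: tensor_carrier_diff Q_closed)
  qed
  then show ?thesis by (simp add: p Q_def)
qed

text \<open>The coordinates of a basis element are a Kronecker delta and \<iota> preserves 0 and 1,
  so the extended functionals are dual to the elements \<open>emb b\<close>.\<close>

lemma ext_coord_basis:
  assumes "b \<in> B" "b' \<in> B"
  shows "ext_coord b (emb b') = (if b = b' then \<one>\<^bsub>L\<^esub> else \<zero>\<^bsub>L\<^esub>)"
proof -
  have "(\<Oplus>\<^bsub>X\<^esub>j\<in>B. (if b' = j then \<one>\<^bsub>K\<^esub> else \<zero>\<^bsub>K\<^esub>) \<odot>\<^bsub>X\<^esub> j) =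
      (\<Oplus>\<^bsub>X\<^esub>j\<in>B. if b' = j then j else \<zero>\<^bsub>X\<^esub>)"
    by (intro M.finsum_cong') auto
  also have "\<dots> = b'"
    using assms finite_B by (intro M.finsum_singleton) auto
  finally have "coord b' b = (if b' = b then \<one>\<^bsub>K\<^esub> else \<zero>\<^bsub>K\<^esub>)"
    using assms by (intro coord_eqI) (auto simp: lincomb_def)
  moreover have "\<iota> \<one>\<^bsub>K\<^esub> = \<one>\<^bsub>L\<^esub>" using ring_hom_one[OF hom] .
  moreover have "\<iota> \<zero>\<^bsub>K\<^esub> = \<zero>\<^bsub>L\<^esub>"
    using ring_hom_zero[OF hom] R.ring_axioms L.ring_axioms by blast
  ultimately show ?thesis using assms by (simp add: ext_coord_emb)
qed

lemma inj_on_emb: "inj_on emb B"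
proof (rule inj_onI, rule ccontr)
  fix b b' assume b: "b \<in> B" "b' \<in> B" and eq: "emb b = emb b'" and "b \<noteq> b'"
  then show False
    using ext_coord_basis[OF b(1) b(1)] ext_coord_basis[OF b] one_neq_zero by simp
qed

text \<open>Duality reads off the coefficients of a combination; linear independence of the extended
  basis follows.\<close>

lemma ext_coord_finsum:
  assumes b: "b \<in> B" and a: "a \<in> B \<rightarrow> carrier L"
  shows "ext_coord b (\<Oplus>\<^bsub>E\<^esub>j\<in>B. a j \<odot>\<^bsub>E\<^esub> emb j) = a b"
proof -
  have "ext_coord b (\<Oplus>\<^bsub>E\<^esub>j\<in>B. a j \<odot>\<^bsub>E\<^esub> emb j) = (\<Oplus>\<^bsub>L\<^esub>j\<in>B. ext_coord b (a j \<odot>\<^bsub>E\<^esub> emb j))"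
    by (rule finsum_additive) (use b a finite_B in \<open>auto simp: ext_coord_closed ext_coord_add emb_closed Pi_iff
        E.M.abelian_group_axioms L.abelian_group_axioms\<close>)
  also have "\<dots> = (\<Oplus>\<^bsub>L\<^esub>j\<in>B. if b = j then a j else \<zero>\<^bsub>L\<^esub>)"
    using a b by (intro L.finsum_cong') (auto simp: ext_coord_smult ext_coord_basis emb_closed Pi_iff)
  also have "\<dots> = a b"
    using a b finite_B by (intro L.finsum_singleton) auto
  finally show ?thesis .
qed

lemma finsum_emb_image:
  assumes "a \<in> emb ` B \<rightarrow> carrier L"
  shows "(\<Oplus>\<^bsub>E\<^esub>e\<in>emb ` B. a e \<odot>\<^bsub>E\<^esub> e) = (\<Oplus>\<^bsub>E\<^esub>b\<in>B. a (emb b) \<odot>\<^bsub>E\<^esub> emb b)"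
  using assms by (intro E.M.finsum_reindex inj_on_emb) (auto simp: emb_closed Pi_iff)

text \<open>Moves families indexed by \<open>B\<close> to the image basis; injectivity of
  \<open>emb\<close> on \<open>B\<close> makes the index recoverable.\<close>

definition pull where "pull f e = f (inv_into B emb e)"

lemma pull_emb [simp]: "b \<in> B \<Longrightarrow> pull f (emb b) = f b"
  by (simp add: pull_def inj_on_emb)

theorem finite_basis_extend_scalars: "finite_basis L E (emb ` B)"
  unfolding finite_basis_def
proof (intro conjI ballI impI)
  show "finite (emb ` B)" using finite_B by simp
  show "emb ` B \<subseteq> carrier E" by (auto simp: emb_closed)
next
  fix z assume z: "z \<in> carrier E"
  show "\<exists>a\<in>emb ` B \<rightarrow> carrier L. z = (\<Oplus>\<^bsub>E\<^esub>e\<in>emb ` B. a e \<odot>\<^bsub>E\<^esub> e)"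
  proof (intro bexI)
    show a: "pull (\<lambda>b. ext_coord b z) \<in> emb ` B \<rightarrow> carrier L"
      using z by (auto simp: ext_coord_closed)
    have "(\<Oplus>\<^bsub>E\<^esub>e\<in>emb ` B. pull (\<lambda>b. ext_coord b z) e \<odot>\<^bsub>E\<^esub> e) = (\<Oplus>\<^bsub>E\<^esub>b\<in>B. ext_coord b z \<odot>\<^bsub>E\<^esub> emb b)"
      unfolding finsum_emb_image[OF a]
      using z by (intro E.M.finsum_cong') (auto simp: ext_coord_closed emb_closed)
    then show "z = (\<Oplus>\<^bsub>E\<^esub>e\<in>emb ` B. pull (\<lambda>b. ext_coord b z) e \<odot>\<^bsub>E\<^esub> e)"
      using z by (simp add: ext_coord_expansion)
  qed
next
  fix a e assume a: "a \<in> emb ` B \<rightarrow> carrier L"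
    and 0: "(\<Oplus>\<^bsub>E\<^esub>e\<in>emb ` B. a e \<odot>\<^bsub>E\<^esub> e) = \<zero>\<^bsub>E\<^esub>" and "e \<in> emb ` B"
  then obtain b where b: "b \<in> B" "e = emb b" by auto
  have a': "(\<lambda>b. a (emb b)) \<in> B \<rightarrow> carrier L" using a by auto
  have "a e = ext_coord b \<zero>\<^bsub>E\<^esub>"
    using ext_coord_finsum[OF b(1) a'] 0 b by (simp add: finsum_emb_image[OF a])
  \<comment> \<open>Writing zero as 0 times 0 lets homogeneity show that the functional vanishes
    there.\<close>
  also have "\<dots> = ext_coord b (\<zero>\<^bsub>L\<^esub> \<odot>\<^bsub>E\<^esub> \<zero>\<^bsub>E\<^esub>)" by simp
  also have "\<dots> = \<zero>\<^bsub>L\<^esub>"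
    using b by (simp only: ext_coord_smult L.zero_closed E.M.zero_closed) (simp add: ext_coord_closed)
  finally show "a e = \<zero>\<^bsub>L\<^esub>" .
qed

sublocale ext: based_module L E "emb ` B"
  by unfold_locales (rule finite_basis_extend_scalars)

text \<open>Uniqueness of coordinates identifies those chosen abstractly for the image basis with
  the explicit functionals, whose values on \<open>emb x\<close> are known.\<close>

lemma ext_coord_eq:
  assumes z: "z \<in> carrier E" and b: "b \<in> B"
  shows "ext.coord z (emb b) = ext_coord b z"
proof -
  have a: "ext.coord z \<in> emb ` B \<rightarrow> carrier L" using z by (rule ext.coord_Pi)
  then have "ext_coord b (ext.lincomb (ext.coord z)) = ext.coord z (emb b)"
    unfolding ext.lincomb_def finsum_emb_image[OF a] by (intro ext_coord_finsum b) auto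
  then show ?thesis using z by (simp add: ext.lincomb_coord)
qed

text \<open>The coordinates of \<open>emb x\<close> are the images under \<iota> of those of
  \<open>x\<close>, so a trivial kernel of \<iota> is inherited by \<open>emb\<close>.\<close>

lemma emb_eq_zero_imp:
  assumes inj: "\<And>a. a \<in> carrier K \<Longrightarrow> \<iota> a = \<zero>\<^bsub>L\<^esub> \<Longrightarrow> a = \<zero>\<^bsub>K\<^esub>"
    and x: "x \<in> carrier X" and 0: "emb x = \<zero>\<^bsub>E\<^esub>"
  shows "x = \<zero>\<^bsub>X\<^esub>"
proof (rule coord_inj)
  fix b assume b: "b \<in> B"
  have "\<iota> (coord x b) = ext_coord b \<zero>\<^bsub>E\<^esub>"
    using ext_coord_emb[OF b x] 0 by simp
  also have "\<dots> = ext_coord b (\<zero>\<^bsub>L\<^esub> \<odot>\<^bsub>E\<^esub> \<zero>\<^bsub>E\<^esub>)" by simp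
  also have "\<dots> = \<zero>\<^bsub>L\<^esub>"
    using b by (simp only: ext_coord_smult L.zero_closed E.M.zero_closed) (simp add: ext_coord_closed)
  finally have "coord x b = \<zero>\<^bsub>K\<^esub>" using inj x b by simp
  moreover have "coord \<zero>\<^bsub>X\<^esub> b = \<zero>\<^bsub>K\<^esub>"
    using coord_smult[of "\<zero>\<^bsub>X\<^esub>" "\<zero>\<^bsub>K\<^esub>" b] b by simp
  ultimately show "coord x b = coord \<zero>\<^bsub>X\<^esub> b" by simp
qed (use x in auto)

lemma emb_zero: "emb \<zero>\<^bsub>X\<^esub> = \<zero>\<^bsub>E\<^esub>"
  using tensor_add_right[of "\<one>\<^bsub>L\<^esub>" "\<zero>\<^bsub>X\<^esub>" "\<zero>\<^bsub>X\<^esub>"] emb_closed[of "\<zero>\<^bsub>X\<^esub>"]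
    E.M.add.r_cancel_one by simp

text \<open>A box around \<open>coord x\<close> inside \<open>U\<close> is lifted factor by factor
  through \<iota>. As \<open>B\<close> is finite, the lifted conditions together still define an
  open set.\<close>

lemma openin_coordinate_topology_lift:
  assumes top: "topspace S' = carrier L"
    and lift: "\<And>V a. openin S V \<Longrightarrow> a \<in> V \<Longrightarrow>
      \<exists>W. openin S' W \<and> \<iota> a \<in> W \<and> (\<forall>a'\<in>carrier K. \<iota> a' \<in> W \<longrightarrow> a' \<in> V)"
    and U: "openin (coordinate_topology S) U" and x: "x \<in> U"
  obtains W where "openin (ext.coordinate_topology S') W" "emb x \<in> W"
    "\<And>y. y \<in> carrier X \<Longrightarrow> emb y \<in> W \<Longrightarrow> y \<in> U"
proof -
  obtain P where P: "openin (product_topology (\<lambda>_. S) B) P" "U = coord -` P \<inter> carrier X"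
    using U by (auto simp: coordinate_topology_def openin_pullback_topology)
  have xX: "x \<in> carrier X" and "coord x \<in> P" using P x by auto
  then obtain V where V: "\<And>b. b \<in> B \<Longrightarrow> openin S (V b)" "coord x \<in> Pi\<^sub>E B V" "Pi\<^sub>E B V \<subseteq> P"
    using P(1)[unfolded openin_product_topology_alt, rule_format, of "coord x"] by blast
  have "\<forall>b\<in>B. \<exists>W. openin S' W \<and> \<iota> (coord x b) \<in> W \<and> (\<forall>a'\<in>carrier K. \<iota> a' \<in> W \<longrightarrow> a' \<in> V b)"
    by (intro ballI lift V(1) PiE_mem[OF V(2)])
  from bchoice[OF this] obtain W where W: "\<And>b. b \<in> B \<Longrightarrow> openin S' (W b)"
    "\<And>b. b \<in> B \<Longrightarrow> \<iota> (coord x b) \<in> W b"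
    "\<And>b a. b \<in> B \<Longrightarrow> a \<in> carrier K \<Longrightarrow> \<iota> a \<in> W b \<Longrightarrow> a \<in> V b"
    by blast
  let ?C = "ext.coordinate_topology S'"
  \<comment> \<open>Intersecting with the whole space matters for empty \<open>B\<close>, when the
    indexed intersection is the universe of the type.\<close>
  let ?W = "(\<Inter>b\<in>B. {z \<in> topspace ?C. ext.coord z (emb b) \<in> W b}) \<inter> topspace ?C"
  have topC: "topspace ?C = carrier E" using top by simp
  show thesis
  proof (rule that[of ?W])
    show "openin ?C ?W"
    proof (rule openin_INT[OF finite_B])
      fix b assume b: "b \<in> B"
      show "openin ?C {z \<in> topspace ?C. ext.coord z (emb b) \<in> W b}"
        using ext.continuous_map_coord[of "emb b" S'] W(1)[OF b] b
        by (intro openin_continuous_map_preimage) auto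
    qed
    show "emb x \<in> ?W"
      using W(2) xX by (auto simp: topC emb_closed ext_coord_eq ext_coord_emb)
    fix y assume y: "y \<in> carrier X" and yW: "emb y \<in> ?W"
    have "coord y b \<in> V b" if b: "b \<in> B" for b
    proof -
      have "ext.coord (emb y) (emb b) \<in> W b" using yW b by blast
      then have "\<iota> (coord y b) \<in> W b" using y b by (simp add: emb_closed ext_coord_eq ext_coord_emb)
      then show ?thesis using W(3) y b by simp
    qed
    then have "coord y \<in> Pi\<^sub>E B V"
      using coord_PiE[OF y] by (auto simp: PiE_def Pi_iff)
    then show "y \<in> U" using V(3) P(2) y by auto
  qed
qed

end

section \<open>The Hausdorff criterion\<close>

theorem proposition5p2:
  fixes K :: "('k, 'm) ring_scheme" and \<nu> :: "'k \<Rightarrow> real"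
    and X :: "('k, 'x, 'n) module_scheme" and T :: "'x topology"
  assumes "valuation_field K \<nu>" and "nontrivial_valuation K \<nu>"
    and "Module.module K X" and "finite_dimensional K X"
    and "T \<in> compatible_topologies K (val_topology K \<nu>) X"
  shows "Hausdorff_space T \<longleftrightarrow>
    F_hat K \<nu> X T \<inter> hat_embed K \<nu> X ` carrier X = {\<zero>\<^bsub>hat_space K \<nu> X\<^esub>}"
proof -
  let ?L = "completion K \<nu>" and ?\<iota> = "to_completion K \<nu>"
  let ?S = "val_topology ?L (completion_val \<nu>)"
  interpret V: valuation_field K \<nu> by (rule assms(1))
  have L: "valuation_field ?L (completion_val \<nu>)" by (rule V.valuation_field_completion)
  obtain B where B: "finite_basis K X B" using assms(4) by (auto simp: finite_dimensional_def)
  have one: "\<one>\<^bsub>?L\<^esub> \<noteq> \<zero>\<^bsub>?L\<^esub>"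
    using domain.one_not_zero[OF field.axioms(1)[OF V.field_completion]] .
  interpret based_scalar_extension K X ?L ?\<iota> B
    by (intro based_scalar_extension.intro scalar_extension.intro scalar_extension_axioms.intro
        based_module.intro based_module_axioms.intro based_scalar_extension_axioms.intro
        assms(3) V.cring_completion V.to_completion_ring_hom B one)
  let ?I = "hat_embed K \<nu> X" and ?T = "hat_topology K \<nu> X" and ?Z = "hat_space K \<nu> X"
  have I: "?I x = tensor K ?L ?\<iota> X \<one>\<^bsub>?L\<^esub> x" for x by (simp add: hat_embed_def)
  have top: "topspace ?S = carrier ?L"
    by (rule valuation_field.topspace_val_topology[OF L])
  \<comment> \<open>The largest compatible topology becomes concrete, with coordinates taken in the
    basis of elements \<open>emb b\<close>.\<close>
  have T: "?T = ext.coordinate_topology ?S"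
    unfolding hat_topology_def hat_space_def
    by (intro ext.max_topology_eq_coordinate_topology top
        valuation_field.continuous_map_val_add[OF L] valuation_field.continuous_map_val_mult[OF L])
  have topT: "topspace ?T = carrier ?Z"
    unfolding T hat_space_def using top by simp
  have I_closed: "?I x \<in> carrier ?Z" if "x \<in> carrier X" for x
    unfolding I hat_space_def using that by (rule emb_closed)
  have I_0: "?I \<zero>\<^bsub>X\<^esub> = \<zero>\<^bsub>?Z\<^esub>"
    unfolding I hat_space_def by (rule emb_zero)
  have tT: "topspace T = carrier X" using assms(5) by (simp add: compatible_topologies_def)
  \<comment> \<open>A point of every neighbourhood U of 0 has its image in I(U) and so in its
    closure. This serves the zero vector and, in the converse direction, a vector inseparable from
    0.\<close>
  have in_F: "?I x \<in> F_hat K \<nu> X T" if "x \<in> carrier X" "\<And>U. openin T U \<Longrightarrow> \<zero>\<^bsub>X\<^esub> \<in> U \<Longrightarrow> x \<in> U" for x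
    unfolding F_hat_def
  proof (rule INT_I)
    fix U assume "U \<in> {U. openin T U \<and> \<zero>\<^bsub>X\<^esub> \<in> U}"
    then have U: "openin T U" "\<zero>\<^bsub>X\<^esub> \<in> U" by auto
    have "?I ` U \<subseteq> topspace ?T"
      using openin_subset[OF U(1)] tT topT I_closed by auto
    then have "?I ` U \<subseteq> ?T closure_of ?I ` U" by (rule closure_of_subset)
    then show "?I x \<in> ?T closure_of ?I ` U" using that(2)[OF U] by blast
  qed
  show ?thesis
  proof
    assume H: "Hausdorff_space T"
    have "x = \<zero>\<^bsub>X\<^esub>" if x: "x \<in> carrier X" and F: "?I x \<in> F_hat K \<nu> X T" for x
    proof (rule ccontr)
      assume "x \<noteq> \<zero>\<^bsub>X\<^esub>"
      with H x tT obtain U W where U: "openin T U" "\<zero>\<^bsub>X\<^esub> \<in> U" and W: "openin T W" "x \<in> W"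
        and disj: "disjnt U W"
        unfolding Hausdorff_space_def by (metis M.zero_closed)
      \<comment> \<open>Every \<open>T\<close>-open set is open for the coordinate topology, so
        \<open>W\<close> can be lifted to an open neighbourhood \<open>Q\<close> of I(x).\<close>
      have "openin (coordinate_topology (val_topology K \<nu>)) W"
        using assms(5) W(1) by (rule coordinate_topology_finest)
      then obtain Q where Q: "openin ?T Q" "?I x \<in> Q" "\<And>y. y \<in> carrier X \<Longrightarrow> ?I y \<in> Q \<Longrightarrow> y \<in> W"
        using openin_coordinate_topology_lift[OF top V.openin_val_topology_lift _ W(2)]
        unfolding T I by metis
      have "?I x \<in> ?T closure_of (?I ` U)"
        using F U unfolding F_hat_def by blast
      \<comment> \<open>As I(x) lies in the closure of I(U), its neighbourhood \<open>Q\<close>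
        contains some I(y) with y in U; then y also lies in \<open>W\<close>, against
        disjointness.\<close>
      then obtain y where "y \<in> U" "?I y \<in> Q"
        using Q(1,2) unfolding in_closure_of by blast
      then show False
        using Q(3) disj openin_subset[OF U(1)] tT by (auto simp: disjnt_iff)
    qed
    then show "F_hat K \<nu> X T \<inter> ?I ` carrier X = {\<zero>\<^bsub>?Z\<^esub>}"
      using in_F[of "\<zero>\<^bsub>X\<^esub>"] I_0 by (auto simp: image_iff)
  next
    assume F: "F_hat K \<nu> X T \<inter> ?I ` carrier X = {\<zero>\<^bsub>?Z\<^esub>}"
    show "Hausdorff_space T"
    \<comment> \<open>It suffices to separate nonzero vectors from 0; an inseparable one would have
      its image in the intersection, which is zero.\<close>
    proof (rule Hausdorff_space_compatibleI[OF assms(5)], rule ccontr)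
      fix x assume x: "x \<in> carrier X" "x \<noteq> \<zero>\<^bsub>X\<^esub>"
        and "\<not> (\<exists>U. openin T U \<and> \<zero>\<^bsub>X\<^esub> \<in> U \<and> x \<notin> U)"
      then have "?I x \<in> F_hat K \<nu> X T" by (intro in_F) auto
      then have "?I x = \<zero>\<^bsub>?Z\<^esub>" using F x(1) by blast
      then have "x = \<zero>\<^bsub>X\<^esub>"
        unfolding I hat_space_def
        \<comment> \<open>The embedding of \<open>K\<close> preserves the valuation, so its kernel
          is trivial.\<close>
        by (rule emb_eq_zero_imp[rotated 2])
          (use x V.completion_val_to_completion V.val_eq_0_iff
             valuation_field.val_eq_0_iff[OF L] cring.cring_simprules(2)[OF V.cring_completion] in metis)+
      with x(2) show False by simp
    qed
  qed
qed

end
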